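(* Let $m,n\ge 2$, let $(X,d)$ be a (nonempty) compact metric space and let $\mathcal S=(X,(\phi_j)_{j=0,\dots,n-1},(p_j)_{j=0,\dots,n-1})$ be a GIFSpdp of degree $m$ satisfying the following two hypotheses. (E1) For each $j$ there are $a_{j,0},\dots,a_{j,m-1}>0$ with $\sum_{k}a_{j,k}<1$ such that $d(\phi_j(x),\phi_j(y))\le\sum_{k=0}^{m-1}a_{j,k}\,d(x_k,y_k)$ for all $x,y\in X^m$. (E2) There is $\delta>0$ such that $p_j(x)\ge\delta$ for all $j$ and all $x\in X^m$. Moreover, for each $j$ there are $c_{j,0},\dots,c_{j,m-1}>0$ with $\sum_k c_{j,k}<1$ such that $|p_j(x)-p_j(y)|\le\sum_{k=0}^{m-1}c_{j,k}\,d(x_k,y_k)$ for all $x,y\in X^m$. Let $A(\hat{\mathcal S})\subseteq X^m$ be the attractor of the extension $\hat{\mathcal S}$ of $\mathcal S$. Then for any fixed $x_0,x_1,\dots,x_{m-1}\in X$ and for $P_{(x_0,\dots,x_{m-1})}$-almost every $a\in\Omega=\{0,\dots,n-1\}^{\mathbb N}$, $$A(\hat{\mathcal S})=\lim_{k\to\infty}\overline{\{(x_N(a),\dots,x_{N+m-1}(a)):N\ge k\}},$$ where the limit is in the Hausdorff metric and $(x_N(a))_{N\ge 0}$ is the orbit of $(x_0,\dots,x_{m-1})$ by $a$. In particular, for almost every such $a$, $\mathrm{proj}_x A(\hat{\mathcal S})=\lim_{k\to\infty}\overline{\{x_N(a):N\ge k\}}$ in the Hausdorff metric, where $\mathrm{proj}_x:X^m\to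 X$ is the projection onto the first coordinate.
   Context: $X^m$ carries the metric $d_\infty(x,y)=\max_k d(x_k,y_k)$, and points are written $x=(x_0,\dots,x_{m-1})$. A generalized iterated function system with place dependent probabilities (GIFSpdp) of degree $m$ with $n$ maps is a family of continuous maps $\phi_j:X^m\to X$ together with weight functions $p_j:X^m\to[0,1]$, $j=0,\dots,n-1$, such that $\sum_j p_j(x)=1$ for all $x\in X^m$. Its extension $\hat{\mathcal S}$ is the iterated function system on $X^m$ with maps $\hat\phi_j(x_0,\dots,x_{m-1})=(x_1,\dots,x_{m-1},\phi_j(x_0,\dots,x_{m-1}))$. Its attractor $A(\hat{\mathcal S})$ is the unique nonempty compact set $B\subseteq X^m$ with $\bigcup_{j}\hat\phi_j(B)=B$ (existence and uniqueness hold under (E1)). Orbit: for $a=(a_0,a_1,\dots)\in\Omega$ and $(x_0,\dots,x_{m-1})\in X^m$, set $x_k(a)=x_k$ for $0\le k\le m-1$ and $x_{j+m}(a)=\phi_{a_j}(x_j(a),\dots,x_{j+m-1}(a))$ for $j\ge0$. $P_{(x_0,\dots,x_{m-1})}$ is the Borel probability measure on $\Omega$ (product topology) determined by its values on cylinders, $$P_{(x_0,\dots,x_{m-1})}(\{v\in\Omega: v_0=w_0,\dots,v_{N-1}=w_{N-1}\})=\prod_{j=0}^{N-1}p_{w_j}(x_j(w),\dots,x_{j+m-1}(w)).$$ *)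

theory Defs
  imports "HOL-Probability.Probability"
begin

(* A point of X^m is an extensional function on {..<m}; the meaning is intended for m \<ge> 1
   (for m = 0 the Max below ranges over the empty set). *)

definition power_space :: "'a set \<Rightarrow> nat \<Rightarrow> (nat \<Rightarrow> 'a) set" where
  "power_space X m = (\<Pi>\<^sub>E k\<in>{..<m}. X)"

definition dist_inf :: "('a \<Rightarrow> 'a \<Rightarrow> real) \<Rightarrow> nat \<Rightarrow> (nat \<Rightarrow> 'a) \<Rightarrow> (nat \<Rightarrow> 'a) \<Rightarrow> real" where
  "dist_inf d m x y = (MAX k\<in>{..<m}. d (x k) (y k))"

lemma Metric_space_dist_inf:
  assumes "Metric_space X d" and "m \<ge> 1"
  shows "Metric_space (power_space X m) (dist_inf d m)"
proof -
  interpret Metric_space X d by fact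
  have ne: "(\<lambda>k. d (x k) (y k)) ` {..<m} \<noteq> {}" for x y :: "nat \<Rightarrow> 'a"
    using assms(2) by (auto simp: lessThan_empty_iff)
  have le: "dist_inf d m x y \<le> r \<longleftrightarrow> (\<forall>k<m. d (x k) (y k) \<le> r)" for x y r
    unfolding dist_inf_def using ne by (subst Max_le_iff) auto
  have ge: "d (x k) (y k) \<le> dist_inf d m x y" if "k < m" for x y k
    using le[of x y "dist_inf d m x y"] that by auto
  show ?thesis
  proof
    show "0 \<le> dist_inf d m x y" for x y
      using ge[of 0 x y] assms(2) nonneg[of "x 0" "y 0"] by linarith
    show "dist_inf d m x y = dist_inf d m y x" for x y
      by (simp add: dist_inf_def commute)
  next
    fix x y assume xy: "x \<in> power_space X m" "y \<in> power_space X m"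
    show "dist_inf d m x y = 0 \<longleftrightarrow> x = y"
    proof
      assume eq: "dist_inf d m x y = 0"
      show "x = y"
      proof (rule PiE_ext)
        show "x \<in> (\<Pi>\<^sub>E k\<in>{..<m}. X)" "y \<in> (\<Pi>\<^sub>E k\<in>{..<m}. X)"
          using xy by (simp_all add: power_space_def)
        fix k assume k: "k \<in> {..<m}"
        have "d (x k) (y k) = 0"
          using ge[of k x y] k eq nonneg[of "x k" "y k"] by auto
        moreover have "x k \<in> X" "y k \<in> X" using xy k by (auto simp: power_space_def)
        ultimately show "x k = y k" by simp
      qed
    next
      assume "x = y"
      have "d (x k) (x k) = 0" if "k < m" for k
      proof -
        have "x k \<in> X"
          using xy(1) that unfolding power_space_def by (intro PiE_mem[of x]) auto
        thus ?thesis using zero by blast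
      qed
      hence "dist_inf d m x x \<le> 0" unfolding le by (metis order_refl)
      moreover have "0 \<le> dist_inf d m x x"
        using ge[of 0 x x] assms(2) nonneg[of "x 0" "x 0"] by linarith
      ultimately show "dist_inf d m x y = 0" using \<open>x = y\<close> by simp
    qed
  next
    fix x y z
    assume xyz: "x \<in> power_space X m" "y \<in> power_space X m" "z \<in> power_space X m"
    show "dist_inf d m x z \<le> dist_inf d m x y + dist_inf d m y z"
    proof (rule le[THEN iffD2], intro allI impI)
      fix k assume k: "k < m"
      have "x k \<in> X" "y k \<in> X" "z k \<in> X"
        using xyz k unfolding power_space_def by (blast intro: PiE_mem)+
      hence "d (x k) (z k) \<le> d (x k) (y k) + d (y k) (z k)"
        by (rule triangle)
      also have "\<dots> \<le> dist_inf d m x y + dist_inf d m y z"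
        using ge[OF k, of x y] ge[OF k, of y z] by linarith
      finally show "d (x k) (z k) \<le> dist_inf d m x y + dist_inf d m y z" .
    qed
  qed
qed

abbreviation power_topology :: "'a set \<Rightarrow> ('a \<Rightarrow> 'a \<Rightarrow> real) \<Rightarrow> nat \<Rightarrow> (nat \<Rightarrow> 'a) topology" where
  "power_topology X d m \<equiv> Metric_space.mtopology (power_space X m) (dist_inf d m)"

definition GIFSpdp ::
  "'a set \<Rightarrow> ('a \<Rightarrow> 'a \<Rightarrow> real) \<Rightarrow> nat \<Rightarrow> nat \<Rightarrow>
   (nat \<Rightarrow> (nat \<Rightarrow> 'a) \<Rightarrow> 'a) \<Rightarrow> (nat \<Rightarrow> (nat \<Rightarrow> 'a) \<Rightarrow> real) \<Rightarrow> bool" where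
  "GIFSpdp X d m n \<phi> p \<longleftrightarrow>
     (\<forall>j<n. continuous_map (power_topology X d m) (Metric_space.mtopology X d) (\<phi> j)) \<and>
     (\<forall>j<n. \<forall>x\<in>power_space X m. p j x \<in> {0..1}) \<and>
     (\<forall>x\<in>power_space X m. (\<Sum>j<n. p j x) = 1)"

definition extension :: "nat \<Rightarrow> (nat \<Rightarrow> (nat \<Rightarrow> 'a) \<Rightarrow> 'a) \<Rightarrow> nat \<Rightarrow> (nat \<Rightarrow> 'a) \<Rightarrow> (nat \<Rightarrow> 'a)" where
  "extension m \<phi> j x = (\<lambda>k\<in>{..<m}. if Suc k < m then x (Suc k) else \<phi> j x)"

definition attractor ::
  "'a set \<Rightarrow> ('a \<Rightarrow> 'a \<Rightarrow> real) \<Rightarrow> nat \<Rightarrow> nat \<Rightarrow> (nat \<Rightarrow> (nat \<Rightarrow> 'a) \<Rightarrow> 'a) \<Rightarrow> (nat \<Rightarrow> 'a) set" where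
  "attractor X d m n \<phi> =
     (THE B. B \<noteq> {} \<and> compactin (power_topology X d m) B \<and>
             (\<Union>j<n. extension m \<phi> j ` B) = B)"

lemma restrict_fundef_cong [fundef_cong]:
  "I = J \<Longrightarrow> (\<And>i. i \<in> J \<Longrightarrow> f i = g i) \<Longrightarrow> restrict f I = restrict g J"
  by (auto simp: restrict_def)

function orbit ::
  "nat \<Rightarrow> (nat \<Rightarrow> (nat \<Rightarrow> 'a) \<Rightarrow> 'a) \<Rightarrow> (nat \<Rightarrow> 'a) \<Rightarrow> (nat \<Rightarrow> nat) \<Rightarrow> nat \<Rightarrow> 'a" where
  "orbit m \<phi> x a k =
     (if k < m then x k
      else \<phi> (a (k - m)) (restrict (\<lambda>i. orbit m \<phi> x a (k - m + i)) {..<m}))"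
  by pat_completeness auto
termination
  by (relation "Wellfounded.measure (\<lambda>(m, \<phi>, x, a, k). k)") auto

declare orbit.simps [simp del]

definition orbit_window ::
  "nat \<Rightarrow> (nat \<Rightarrow> (nat \<Rightarrow> 'a) \<Rightarrow> 'a) \<Rightarrow> (nat \<Rightarrow> 'a) \<Rightarrow> (nat \<Rightarrow> nat) \<Rightarrow> nat \<Rightarrow> (nat \<Rightarrow> 'a)" where
  "orbit_window m \<phi> x a j = (\<lambda>i\<in>{..<m}. orbit m \<phi> x a (j + i))"

lemma orbit_initial: "k < m \<Longrightarrow> orbit m \<phi> x a k = x k"
  by (simp add: orbit.simps)

lemma orbit_step: "orbit m \<phi> x a (j + m) = \<phi> (a j) (orbit_window m \<phi> x a j)"
  by (subst orbit.simps) (simp add: orbit_window_def)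

definition code_topology :: "nat \<Rightarrow> (nat \<Rightarrow> nat) topology" where
  "code_topology n = product_topology (\<lambda>_. discrete_topology {..<n}) UNIV"

definition code_borel :: "nat \<Rightarrow> (nat \<Rightarrow> nat) measure" where
  "code_borel n = sigma (topspace (code_topology n)) {U. openin (code_topology n) U}"

definition cylinder :: "nat \<Rightarrow> (nat \<Rightarrow> nat) \<Rightarrow> nat \<Rightarrow> (nat \<Rightarrow> nat) set" where
  "cylinder n w N = {v \<in> topspace (code_topology n). \<forall>i<N. v i = w i}"

(* The factors with j < N depend on w only through w 0, ..., w (N - 1). *)
definition orbit_measure ::
  "nat \<Rightarrow> nat \<Rightarrow> (nat \<Rightarrow> (nat \<Rightarrow> 'a) \<Rightarrow> 'a) \<Rightarrow> (nat \<Rightarrow> (nat \<Rightarrow> 'a) \<Rightarrow> real) \<Rightarrow> (nat \<Rightarrow> 'a)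
   \<Rightarrow> (nat \<Rightarrow> nat) measure" where
  "orbit_measure m n \<phi> p x =
     (THE P. prob_space P \<and> sets P = sets (code_borel n) \<and>
        (\<forall>w\<in>topspace (code_topology n). \<forall>N.
           measure P (cylinder n w N) = (\<Prod>j<N. p (w j) (orbit_window m \<phi> x w j))))"

(* The Hausdorff metric on the nonempty compact subsets of a metric space; the
   conditionally complete suprema and infima are only meaningful for such sets. *)

definition nonempty_compacts :: "'a set \<Rightarrow> ('a \<Rightarrow> 'a \<Rightarrow> real) \<Rightarrow> 'a set set" where
  "nonempty_compacts M d = {K. K \<noteq> {} \<and> compactin (Metric_space.mtopology M d) K}"

definition hausdorff_dist :: "('a \<Rightarrow> 'a \<Rightarrow> real) \<Rightarrow> 'a set \<Rightarrow> 'a set \<Rightarrow> real" where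
  "hausdorff_dist d A B =
     max (SUP a\<in>A. INF b\<in>B. d a b) (SUP b\<in>B. INF a\<in>A. d a b)"

definition hausdorff_limit ::
  "'a set \<Rightarrow> ('a \<Rightarrow> 'a \<Rightarrow> real) \<Rightarrow> (nat \<Rightarrow> 'a set) \<Rightarrow> 'a set \<Rightarrow> bool" where
  "hausdorff_limit M d F A \<longleftrightarrow>
     A \<in> nonempty_compacts M d \<and> (\<forall>k. F k \<in> nonempty_compacts M d) \<and>
     (\<lambda>k. hausdorff_dist d (F k) A) \<longlonglongrightarrow> 0"

end

theory Submission
  imports Defs
begin

text \<open>
  The statement splits into a deterministic and a probabilistic half, joined by the notion of a
  \<^emph>\<open>recurrent\<close> code: one in which every finite word over the alphabet occurs at arbitrarily late
  positions.

  Deterministic half. The windows of an orbit are obtained by applying the maps of the extension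
  one after the other. A single map of the extension is only nonexpansive for the maximum metric,
  because it shifts all coordinates but one; after $m$ steps, however, every coordinate is new and
  the hypothesis on the $\phi_j$ gives a factor $s < 1$. So a composition along a word of length
  $N$ contracts by $s^{\lfloor N/m\rfloor}$, uniformly in the word (\<open>orbit_window_contraction\<close>).
  A nonempty compact invariant set $A$ exists by compactness of the space and continuity of
  the maps (\<open>compact_invariant_set_exists\<close>);
  such uniform contraction makes it unique (\<open>invariant_subset\<close>) and makes
  it attract every orbit. If moreover the code is recurrent, then every point of $A$ is approached
  infinitely often: a point of $A$ is the image of another point of $A$ under a long word, and each
  time the orbit reads this word it is carried close to that point, wherever it was before. Hence
  the closed tails of the orbit contain $A$ and shrink towards it
  (\<open>recurrent_code_hausdorff_limit\<close>). The projection to the first coordinate is nonexpansive, so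
  the same two facts give the second claim.

  Probabilistic half. Seen from the code space, the orbit measure is a process in which the
  conditional probability of the next letter, given the past, is at least $\delta$. The measure
  exists by the Ionescu-Tulcea theorem and is unique because cylinders form an intersection-stable
  generator. Given any past, a fixed word of length $L$ comes next with probability at least
  $\delta^L$, so it is missed in $M$ consecutive blocks with probability at most
  $(1-\delta^L)^M$, and almost every code is recurrent (\<open>AE_recurrent\<close>).
\<close>

section \<open>Measures on the code space given by conditional probabilities\<close>

lemma topspace_code_topology: "topspace (code_topology n) = {v. \<forall>i. v i < n}"
  by (auto simp: code_topology_def PiE_iff)

lemma mem_cylinder: "v \<in> cylinder n w N \<longleftrightarrow> (\<forall>i. v i < n) \<and> (\<forall>i<N. v i = w i)"
  by (simp add: cylinder_def topspace_code_topology)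

lemma cylinder_eq: "v \<in> cylinder n w N \<Longrightarrow> cylinder n v N = cylinder n w N"
  by (auto simp: mem_cylinder)

definition cylinders :: "nat \<Rightarrow> nat \<Rightarrow> (nat \<Rightarrow> nat) set set" where
  "cylinders n N = (\<lambda>w. cylinder n w N) ` topspace (code_topology n)"

lemma finite_cylinders: "finite (cylinders n N)"
proof (rule finite_subset)
  show "cylinders n N \<subseteq> (\<lambda>w. cylinder n w N) ` ({..<N} \<rightarrow>\<^sub>E {..<n})"
  proof (clarsimp simp: cylinders_def topspace_code_topology)
    fix w :: "nat \<Rightarrow> nat" assume w: "\<forall>i. w i < n"
    show "cylinder n w N \<in> (\<lambda>w. cylinder n w N) ` ({..<N} \<rightarrow>\<^sub>E {..<n})"
    proof (rule image_eqI)
      show "cylinder n w N = cylinder n (restrict w {..<N}) N"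
        by (auto simp: mem_cylinder)
      show "restrict w {..<N} \<in> {..<N} \<rightarrow>\<^sub>E {..<n}"
        using w by auto
    qed
  qed
qed (simp add: finite_PiE)

lemma cylinders_disjoint:
  "C \<in> cylinders n N \<Longrightarrow> D \<in> cylinders n N \<Longrightarrow> C \<noteq> D \<Longrightarrow> C \<inter> D = {}"
  unfolding cylinders_def using cylinder_eq by blast

text \<open>
  The events decided by the first \<open>N\<close> letters. They form the finite algebra generated by the
  cylinders of length \<open>N\<close>, the \<open>N\<close>-th stage of the natural filtration of the letter process.
\<close>

definition prefix_determined :: "nat \<Rightarrow> nat \<Rightarrow> (nat \<Rightarrow> nat) set \<Rightarrow> bool" where
  "prefix_determined n N E \<longleftrightarrow>
     E \<subseteq> topspace (code_topology n) \<and> (\<forall>v\<in>E. cylinder n v N \<subseteq> E)"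

lemma prefix_determined_mono:
  "prefix_determined n N E \<Longrightarrow> N \<le> N' \<Longrightarrow> prefix_determined n N' E"
  unfolding prefix_determined_def by (fastforce simp: mem_cylinder)

lemma prefix_determined_Union:
  assumes "prefix_determined n N E"
  shows "E = \<Union>{C \<in> cylinders n N. C \<subseteq> E}"
proof
  show "E \<subseteq> \<Union>{C \<in> cylinders n N. C \<subseteq> E}"
  proof
    fix v assume v: "v \<in> E"
    hence "v \<in> topspace (code_topology n)" "cylinder n v N \<subseteq> E"
      using assms by (auto simp: prefix_determined_def)
    moreover from this have "v \<in> cylinder n v N"
      by (simp add: mem_cylinder topspace_code_topology)
    ultimately show "v \<in> \<Union>{C \<in> cylinders n N. C \<subseteq> E}"
      by (auto simp: cylinders_def)
  qed
qed auto

lemma prefix_determined_in_sigma: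
  assumes "prefix_determined n N E"
  shows "E \<in> sigma_sets (topspace (code_topology n)) (\<Union>N. cylinders n N)"
proof -
  have "countable {C \<in> cylinders n N. C \<subseteq> E}"
    by (intro countable_finite finite_subset[OF _ finite_cylinders]) auto
  thus ?thesis
    by (subst prefix_determined_Union[OF assms]) (rule sigma_sets_UNION, auto)
qed

lemma cylinder_open: "openin (code_topology n) (cylinder n w N)"
proof -
  have "openin (code_topology n) (\<Pi>\<^sub>E i\<in>UNIV. {..<n} \<inter> (if i < N then {w i} else UNIV))"
    unfolding code_topology_def
  proof (subst openin_PiE_gen, intro disjI2 conjI)
    have "{i \<in> UNIV. {..<n} \<inter> (if i < N then {w i} else UNIV) \<noteq>
             topspace (discrete_topology {..<n})} \<subseteq> {..<N}"
      by auto
    thus "finite {i \<in> UNIV. {..<n} \<inter> (if i < N then {w i} else UNIV) \<noteq>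
             topspace (discrete_topology {..<n})}"
      using finite_subset by blast
  qed auto
  moreover have "(\<Pi>\<^sub>E i\<in>UNIV. {..<n} \<inter> (if i < N then {w i} else UNIV)) = cylinder n w N"
    by (auto simp: PiE_iff mem_cylinder split: if_splits)
  ultimately show ?thesis by simp
qed

lemma open_contains_cylinder:
  assumes U: "openin (code_topology n) U" and v: "v \<in> U"
  shows "\<exists>N. cylinder n v N \<subseteq> U"
proof -
  obtain V where V: "finite {i. V i \<noteq> {..<n}}" "v \<in> Pi\<^sub>E UNIV V" "Pi\<^sub>E UNIV V \<subseteq> U"
    using U v unfolding code_topology_def openin_product_topology_alt by fastforce
  from V(1) obtain N where N: "\<forall>i. V i \<noteq> {..<n} \<longrightarrow> i < N"
    using finite_nat_set_iff_bounded by auto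
  have "cylinder n v N \<subseteq> Pi\<^sub>E UNIV V"
  proof
    fix u assume u: "u \<in> cylinder n v N"
    have "u i \<in> V i" for i
      using u N V(2) by (cases "i < N") (auto simp: mem_cylinder PiE_iff)
    thus "u \<in> Pi\<^sub>E UNIV V" by (simp add: PiE_iff)
  qed
  with V(3) show ?thesis by blast
qed

text \<open>
  There are only countably many cylinders and they form a basis of the topology, so every open set
  is a countable union of cylinders. This reduces the Borel sets to the sets generated by finite
  words.
\<close>

lemma sets_code_borel:
  "sets (code_borel n) = sigma_sets (topspace (code_topology n)) (\<Union>N. cylinders n N)"
proof -
  have "sigma_sets (topspace (code_topology n)) {U. openin (code_topology n) U} =
        sigma_sets (topspace (code_topology n)) (\<Union>N. cylinders n N)"
  proof (rule sigma_sets_eqI)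
    fix U assume "U \<in> {U. openin (code_topology n) U}"
    hence U: "openin (code_topology n) U" by simp
    define \<C> where "\<C> = {C \<in> (\<Union>N. cylinders n N). C \<subseteq> U}"
    have "countable (\<Union>N. cylinders n N)"
      by (rule countable_UN) (auto intro: countable_finite finite_cylinders)
    hence "countable \<C>"
      unfolding \<C>_def by (rule countable_subset[rotated]) auto
    moreover have "U = \<Union>\<C>"
    proof
      show "U \<subseteq> \<Union>\<C>"
      proof
        fix v assume v: "v \<in> U"
        then obtain N where N: "cylinder n v N \<subseteq> U"
          using open_contains_cylinder[OF U] by blast
        have "v \<in> topspace (code_topology n)"
          using U v openin_subset by blast
        hence "v \<in> cylinder n v N" "cylinder n v N \<in> \<C>"
          using N by (auto simp: \<C>_def cylinders_def mem_cylinder topspace_code_topology)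
        thus "v \<in> \<Union>\<C>" by blast
      qed
    qed (auto simp: \<C>_def)
    moreover have "\<Union>\<C> \<in> sigma_sets (topspace (code_topology n)) (\<Union>N. cylinders n N)"
      using \<open>countable \<C>\<close> by (rule sigma_sets_UNION) (auto simp: \<C>_def)
    ultimately show "U \<in> sigma_sets (topspace (code_topology n)) (\<Union>N. cylinders n N)"
      by simp
  next
    fix C assume "C \<in> (\<Union>N. cylinders n N)"
    thus "C \<in> sigma_sets (topspace (code_topology n)) {U. openin (code_topology n) U}"
      by (auto simp: cylinders_def cylinder_open)
  qed
  moreover have "{U. openin (code_topology n) U} \<subseteq> Pow (topspace (code_topology n))"
    using openin_subset by blast
  ultimately show ?thesis
    by (simp add: code_borel_def)
qed

lemma space_code_borel: "sets P = sets (code_borel n) \<Longrightarrow> space P = topspace (code_topology n)"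
proof -
  assume "sets P = sets (code_borel n)"
  hence "space P = space (code_borel n)" by (rule sets_eq_imp_space_eq)
  thus ?thesis by (simp add: code_borel_def space_measure_of_conv)
qed

lemma prefix_determined_measurable:
  "sets P = sets (code_borel n) \<Longrightarrow> prefix_determined n N E \<Longrightarrow> E \<in> sets P"
  by (simp add: sets_code_borel prefix_determined_in_sigma)

lemma prefix_determined_cylinder: "prefix_determined n N (cylinder n w N)"
  by (auto simp: prefix_determined_def mem_cylinder topspace_code_topology)

text \<open>
  Two cylinders that meet in \<open>u\<close> intersect in a cylinder around \<open>u\<close>; together with the empty set
  they are therefore an intersection-stable generator.
\<close>

lemma code_borel_measure_eqI:
  assumes P: "prob_space P" "sets P = sets (code_borel n)"
    and Q: "prob_space Q" "sets Q = sets (code_borel n)"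
    and eq: "\<And>w N. w \<in> topspace (code_topology n) \<Longrightarrow>
               measure P (cylinder n w N) = measure Q (cylinder n w N)"
  shows "P = Q"
proof -
  interpret P: prob_space P by fact
  interpret Q: prob_space Q by fact
  define \<C> where "\<C> = insert {} (\<Union>N. cylinders n N)"
  have gen: "sets (code_borel n) = sigma_sets (topspace (code_topology n)) \<C>"
    unfolding sets_code_borel \<C>_def
    by (rule sigma_sets_eqI) (auto intro: sigma_sets.Empty)
  show ?thesis
  proof (rule measure_eqI_generator_eq[where A = "\<lambda>_. topspace (code_topology n)"])
    show "Int_stable \<C>"
    proof (rule Int_stableI)
      fix C D assume CD: "C \<in> \<C>" "D \<in> \<C>"
      show "C \<inter> D \<in> \<C>"
      proof (cases "C \<inter> D = {}")
        case False
        then obtain u where u: "u \<in> C" "u \<in> D" by blast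
        with CD obtain w N v M where *: "C = cylinder n w N" "D = cylinder n v M"
          by (auto simp: \<C>_def cylinders_def)
        have "C \<inter> D = cylinder n u (max N M)"
          using u unfolding * by (auto simp: mem_cylinder less_max_iff_disj)
        moreover have "u \<in> topspace (code_topology n)"
          using u(1) unfolding * by (simp add: cylinder_def)
        ultimately show ?thesis by (auto simp: \<C>_def cylinders_def)
      qed (simp add: \<C>_def)
    qed
    show "\<C> \<subseteq> Pow (topspace (code_topology n))"
      by (auto simp: \<C>_def cylinders_def cylinder_def)
    show "emeasure P C = emeasure Q C" if "C \<in> \<C>" for C
      using that eq by (auto simp: \<C>_def cylinders_def P.emeasure_eq_measure Q.emeasure_eq_measure)
    show "sets P = sigma_sets (topspace (code_topology n)) \<C>"
         "sets Q = sigma_sets (topspace (code_topology n)) \<C>"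
      using P Q gen by auto
    have "topspace (code_topology n) \<in> \<C>"
    proof (cases "topspace (code_topology n) = {}")
      case False
      then obtain w where "w \<in> topspace (code_topology n)" by blast
      moreover have "topspace (code_topology n) = cylinder n w 0"
        by (simp add: cylinder_def)
      ultimately show ?thesis by (auto simp: \<C>_def cylinders_def)
    qed (simp add: \<C>_def)
    thus "range (\<lambda>_. topspace (code_topology n)) \<subseteq> \<C>" by simp
  qed auto
qed

text \<open>
  \<open>g N w\<close> is the conditional probability that letter number \<open>N\<close> is \<open>w N\<close>, given that the preceding
  letters are \<open>w 0, \<dots>, w (N - 1)\<close>. The conditions ask for letters below \<open>n\<close> only at the positions
  that matter, so that they also apply to finite words, which are undefined further out.
\<close>

locale code_weights =
  fixes n :: nat and g :: "nat \<Rightarrow> (nat \<Rightarrow> nat) \<Rightarrow> real"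
  assumes g_cong: "\<And>N v w. (\<And>i. i \<le> N \<Longrightarrow> v i = w i) \<Longrightarrow> g N v = g N w"
    and g_nonneg: "\<And>N w. (\<And>i. i \<le> N \<Longrightarrow> w i < n) \<Longrightarrow> g N w \<ge> 0"
    and g_sum: "\<And>N w. (\<And>i. i < N \<Longrightarrow> w i < n) \<Longrightarrow> (\<Sum>j<n. g N (w(N := j))) = 1"
begin

definition is_code_measure :: "(nat \<Rightarrow> nat) measure \<Rightarrow> bool" where
  "is_code_measure P \<longleftrightarrow> prob_space P \<and> sets P = sets (code_borel n) \<and>
     (\<forall>w\<in>topspace (code_topology n). \<forall>N. measure P (cylinder n w N) = (\<Prod>j<N. g j w))"

lemma code_measure_unique: "is_code_measure P \<Longrightarrow> is_code_measure Q \<Longrightarrow> P = Q"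
  unfolding is_code_measure_def by (intro code_borel_measure_eqI) auto

definition letter_measure :: "nat \<Rightarrow> (nat \<Rightarrow> nat) \<Rightarrow> nat measure" where
  "letter_measure N w = density (count_space {..<n}) (\<lambda>j. ennreal (g N (w(N := j))))"

lemma letter_measure_singleton:
  assumes "j < n"
  shows "emeasure (letter_measure N w) {j} = ennreal (g N (w(N := j)))"
  unfolding letter_measure_def using assms
  by (subst emeasure_density) (auto simp: nn_integral_count_space_indicator nn_integral_count_space_finite)

lemma prob_space_letter_measure:
  assumes "\<And>i. i < N \<Longrightarrow> w i < n"
  shows "prob_space (letter_measure N w)"
proof
  have nn: "0 \<le> g N (w(N := j))" if "j < n" for j
    using assms that by (intro g_nonneg) (auto simp: le_less)
  have "emeasure (letter_measure N w) (space (letter_measure N w)) =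
        (\<Sum>j<n. ennreal (g N (w(N := j))))"
    unfolding letter_measure_def
    by (subst emeasure_density) (auto simp: nn_integral_count_space_finite)
  also have "\<dots> = ennreal (\<Sum>j<n. g N (w(N := j)))"
    using nn by (intro sum_ennreal) auto
  finally show "emeasure (letter_measure N w) (space (letter_measure N w)) = 1"
    using g_sum assms by simp
qed

lemma Ionescu_Tulcea_letter_measure:
  "Ionescu_Tulcea letter_measure (\<lambda>_. count_space {..<n})"
proof (rule Ionescu_Tulcea.intro)
  have sp: "space (PiM {0..<N} (\<lambda>_. count_space {..<n})) = ({0..<N} \<rightarrow>\<^sub>E {..<n})" for N
    by (simp add: space_PiM)
  show prob: "prob_space (letter_measure N w)"
    if "w \<in> space (PiM {0..<N} (\<lambda>_. count_space {..<n}))" for N w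
  proof (rule prob_space_letter_measure)
    fix i assume "i < N"
    thus "w i < n" using that PiE_mem[of w "{0..<N}" "\<lambda>_. {..<n}" i] by (simp add: sp)
  qed
  show "letter_measure N \<in>
    PiM {0..<N} (\<lambda>_. count_space {..<n}) \<rightarrow>\<^sub>M subprob_algebra (count_space {..<n})" for N
  proof -
    have "letter_measure N w \<in> space (subprob_algebra (count_space {..<n}))"
      if "w \<in> {0..<N} \<rightarrow>\<^sub>E {..<n}" for w
    proof -
      have "prob_space (letter_measure N w)" using that by (intro prob) (simp only: sp)
      hence "subprob_space (letter_measure N w)" by (rule prob_space_imp_subprob_space)
      thus ?thesis by (simp add: space_subprob_algebra letter_measure_def)
    qed
    thus ?thesis
      by (subst count_space_PiM_finite) auto
  qed
qed

text \<open>
  The Ionescu-Tulcea construction with the finite kernels \<open>letter_measure\<close>. The finite-dimensional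
  product spaces are discrete, so measurability is automatic, and the probability of a finite word
  is computed letter by letter.
\<close>

lemma code_measure_exists: "\<exists>P. is_code_measure P"
proof -
  interpret IT: Ionescu_Tulcea letter_measure "\<lambda>_. count_space {..<n}"
    by (rule Ionescu_Tulcea_letter_measure)
  let ?M = "\<lambda>_::nat. count_space {..<n}"
  let ?u = "\<lambda>_::nat. undefined :: nat"
  have PiM_eq: "PiM {0..<N} ?M = count_space ({0..<N} \<rightarrow>\<^sub>E {..<n})" for N
    by (rule count_space_PiM_finite) auto
  have cyl_emb: "cylinder n w N = prod_emb UNIV ?M {0..<N} {restrict w {0..<N}}" for w N
  proof -
    have "restrict v {0..<N} = restrict w {0..<N} \<longleftrightarrow> (\<forall>i<N. v i = w i)" for v
    proof (intro iffI allI impI)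
      fix i assume "restrict v {0..<N} = restrict w {0..<N}" "i < N"
      thus "v i = w i" by (metis atLeastLessThan_iff le0 restrict_apply')
    qed (auto intro: restrict_ext)
    thus ?thesis
      by (auto simp: mem_cylinder prod_emb_def PiE_iff)
  qed
  have finite_word: "emeasure (IT.C 0 N ?u) {restrict w {0..<N}} = ennreal (\<Prod>j<N. g j w)"
    if w: "\<forall>i. w i < n" for w N
  proof (induction N)
    case 0
    show ?case
      by (simp add: PiM_empty restrict_def)
  next
    case (Suc N)
    have u: "?u \<in> space (PiM {0..<0} ?M)" by (simp add: space_PiM)
    have mem: "restrict w {0..<N} \<in> {0..<N} \<rightarrow>\<^sub>E {..<n}" for N
      using w by auto
    have sets_Suc: "{restrict w {0..<Suc N}} \<in> sets (PiM {0..<Suc N} ?M)"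
      using mem unfolding PiM_eq by simp
    have spC: "space (IT.C 0 N ?u) = ({0..<N} \<rightarrow>\<^sub>E {..<n})"
      using IT.space_C[OF u, of N] by (simp add: space_PiM)
    have setsC: "sets (IT.C 0 N ?u) = sets (PiM {0..<N} ?M)"
      using IT.sets_C[OF u, of N] by simp
    \<comment> \<open>One step of the kernel reaches the longer word only from its own prefix.\<close>
    have step: "emeasure (IT.eP N v) {restrict w {0..<Suc N}} =
                ennreal (g N w) * indicator {restrict w {0..<N}} v"
      if v: "v \<in> {0..<N} \<rightarrow>\<^sub>E {..<n}" for v
    proof -
      have v': "v \<in> space (PiM {0..<N} ?M)" using v by (simp add: space_PiM)
      have outside: "v i = undefined" if "i \<ge> N" for i
        using v that by (auto simp: PiE_iff extensional_def)
      have "(\<lambda>j. v(N := j)) -` {restrict w {0..<Suc N}} \<inter> {..<n} =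
            (if v = restrict w {0..<N} then {w N} else {})"
      proof -
        have "v(N := j) = restrict w {0..<Suc N} \<longleftrightarrow> v = restrict w {0..<N} \<and> j = w N" for j
        proof
          assume eq: "v(N := j) = restrict w {0..<Suc N}"
          have "v i = restrict w {0..<N} i" for i
            using fun_cong[OF eq, of i] outside[of i] by (cases "i < N") auto
          moreover have "j = w N"
            using fun_cong[OF eq, of N] by simp
          ultimately show "v = restrict w {0..<N} \<and> j = w N" by blast
        next
          assume eq: "v = restrict w {0..<N} \<and> j = w N"
          show "v(N := j) = restrict w {0..<Suc N}"
            by (rule ext) (auto simp: eq)
        qed
        hence "(\<lambda>j. v(N := j)) -` {restrict w {0..<Suc N}} \<inter> {..<n} =
               {j. v = restrict w {0..<N} \<and> j = w N} \<inter> {..<n}"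
          by (simp only: vimage_def singleton_iff)
        also have "{j. b \<and> j = w N} \<inter> {..<n} = (if b then {w N} else {})" for b
          using w by auto
        finally show ?thesis .
      qed
      hence "emeasure (IT.eP N v) {restrict w {0..<Suc N}} =
             emeasure (letter_measure N v) (if v = restrict w {0..<N} then {w N} else {})"
        using IT.emeasure_eP[OF v' sets_Suc] by simp
      also have "\<dots> = ennreal (g N w) * indicator {restrict w {0..<N}} v"
      proof (cases "v = restrict w {0..<N}")
        case True
        have "g N (v(N := w N)) = g N w"
          by (rule g_cong) (auto simp: True)
        thus ?thesis using True letter_measure_singleton[of "w N" N v] w by simp
      qed simp
      finally show ?thesis .
    qed
    have "emeasure (IT.C 0 (Suc N) ?u) {restrict w {0..<Suc N}} =
          (\<integral>\<^sup>+v. emeasure (IT.eP N v) {restrict w {0..<Suc N}} \<partial>IT.C 0 N ?u)"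
      unfolding IT.C.simps
    proof (subst emeasure_bind)
      show "space (IT.C 0 N ?u) \<noteq> {}"
        unfolding spC using mem[of N] by blast
      show "IT.eP (0 + N) \<in> IT.C 0 N ?u \<rightarrow>\<^sub>M subprob_algebra (PiM {0..<Suc N} ?M)"
        using IT.measurable_eP[of N] by (simp add: measurable_cong_sets[OF setsC refl])
    qed (use sets_Suc in auto)
    also have "\<dots> = (\<integral>\<^sup>+v. ennreal (g N w) * indicator {restrict w {0..<N}} v \<partial>IT.C 0 N ?u)"
      by (rule nn_integral_cong) (auto simp: spC step)
    also have "\<dots> = ennreal (g N w) * ennreal (\<Prod>j<N. g j w)"
      using mem[of N] by (subst nn_integral_cmult_indicator) (auto simp: setsC PiM_eq Suc)
    also have "\<dots> = ennreal (\<Prod>j<Suc N. g j w)"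
      using w g_nonneg by (simp add: ennreal_mult[symmetric] prod_nonneg mult.commute)
    finally show ?case .
  qed
  have emeasure_lim: "emeasure IT.PF.lim (cylinder n w N) = ennreal (\<Prod>j<N. g j w)"
    if w: "\<forall>i. w i < n" for w N
  proof -
    have mem: "restrict w {0..<N} \<in> {0..<N} \<rightarrow>\<^sub>E {..<n}" using w by auto
    have "emeasure IT.PF.lim (cylinder n w N) =
          emeasure (IT.C 0 N ?u) (prod_emb {0..<N} ?M {0..<N} {restrict w {0..<N}})"
      unfolding cyl_emb using mem
      by (subst IT.lim) (auto simp: PiM_eq IT.emeasure_CI[of _ N])
    also have "prod_emb {0..<N} ?M {0..<N} {restrict w {0..<N}} = {restrict w {0..<N}}"
      using mem by (intro prod_emb_id) (auto simp: space_PiM)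
    also have "emeasure (IT.C 0 N ?u) \<dots> = ennreal (\<Prod>j<N. g j w)"
      by (rule finite_word[OF w])
    finally show ?thesis .
  qed
  have "is_code_measure IT.PF.lim"
    unfolding is_code_measure_def
  proof (intro conjI ballI allI)
    have sets_lim: "sets IT.PF.lim = sets (PiM UNIV ?M)" by simp
    show "sets IT.PF.lim = sets (code_borel n)"
      unfolding sets_lim sets_code_borel sets_PiM_single
    proof -
      have top: "topspace (code_topology n) = (\<Pi>\<^sub>E i\<in>UNIV. space (?M i))"
        by (auto simp: topspace_code_topology PiE_iff)
      show "sigma_sets (\<Pi>\<^sub>E i\<in>UNIV. space (?M i))
              {{f \<in> \<Pi>\<^sub>E i\<in>UNIV. space (?M i). f i \<in> A} |i A. i \<in> UNIV \<and> A \<in> sets (?M i)} =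
            sigma_sets (topspace (code_topology n)) (\<Union>N. cylinders n N)"
      proof (unfold top, rule sigma_sets_eqI, goal_cases)
        case (1 E)
        then obtain i A where E: "E = {f \<in> \<Pi>\<^sub>E i\<in>UNIV. space (?M i). f i \<in> A}" by blast
        have "prefix_determined n (Suc i) E"
          unfolding prefix_determined_def E top by (auto simp: mem_cylinder)
        from prefix_determined_in_sigma[OF this] show ?case by (simp only: top)
      next
        case (2 C)
        then obtain w N where w: "\<forall>i. w i < n" and C: "C = cylinder n w N"
          by (auto simp: cylinders_def topspace_code_topology)
        have "prod_emb UNIV ?M {0..<N} {restrict w {0..<N}} \<in> sets (PiM UNIV ?M)"
          using w by (intro sets_PiM_I_finite measurable_prod_emb) (auto simp: PiM_eq)
        thus ?case unfolding C cyl_emb sets_PiM_single .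
      qed
    qed
    show "prob_space IT.PF.lim"
    proof
      have "n > 0" using IT.non_empty by auto
      hence w: "\<forall>i. (\<lambda>_. 0::nat) i < n" by simp
      have sp: "space IT.PF.lim = cylinder n (\<lambda>_. 0) 0"
        by (auto simp: space_PiM mem_cylinder PiE_iff)
      have "emeasure IT.PF.lim (cylinder n (\<lambda>_. 0) 0) = 1"
        using emeasure_lim[OF w, of 0] by simp
      thus "emeasure IT.PF.lim (space IT.PF.lim) = 1" by (simp only: sp)
    qed
    fix w N assume "w \<in> topspace (code_topology n)"
    hence w: "\<forall>i. w i < n" by (simp add: topspace_code_topology)
    show "measure IT.PF.lim (cylinder n w N) = (\<Prod>j<N. g j w)"
      using emeasure_lim[OF w] w g_nonneg by (simp add: measure_def prod_nonneg)
  qed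
  thus ?thesis by blast
qed

end

section \<open>Every word recurs almost surely\<close>

locale positive_code_weights = code_weights +
  fixes \<delta> :: real and P :: "(nat \<Rightarrow> nat) measure"
  assumes delta_pos: "\<delta> > 0"
    and g_lower: "\<And>N w. (\<And>i. i \<le> N \<Longrightarrow> w i < n) \<Longrightarrow> g N w \<ge> \<delta>"
    and code_measure: "is_code_measure P"
begin

sublocale prob_space P
  using code_measure by (simp add: is_code_measure_def)

lemma sets_P: "sets P = sets (code_borel n)"
  using code_measure by (simp add: is_code_measure_def)

lemma space_P: "space P = topspace (code_topology n)"
  using sets_P by (rule space_code_borel)

lemma measure_cylinder:
  "(\<And>i. w i < n) \<Longrightarrow> measure P (cylinder n w N) = (\<Prod>j<N. g j w)"
  using code_measure by (simp add: is_code_measure_def topspace_code_topology)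

text \<open>
  On each cylinder of length \<open>N\<close> this is the lower bound on the weights; an event of the past is a
  finite disjoint union of such cylinders.
\<close>

lemma measure_next_letter:
  assumes E: "prefix_determined n N E" and j: "j < n"
  shows "measure P {a \<in> E. a N = j} \<ge> \<delta> * measure P E"
proof -
  define \<W> where "\<W> = {C \<in> cylinders n N. C \<subseteq> E}"
  have fin: "finite \<W>"
    unfolding \<W>_def by (rule finite_subset[OF _ finite_cylinders]) auto
  have E_eq: "E = \<Union>\<W>"
    unfolding \<W>_def by (rule prefix_determined_Union[OF E])
  have meas: "C \<in> sets P" if "C \<in> \<W>" for C
    using that prefix_determined_measurable[OF sets_P prefix_determined_cylinder]
    by (auto simp: \<W>_def cylinders_def)
  have disj: "disjoint_family_on (\<lambda>C. C) \<W>"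
    unfolding disjoint_family_on_def \<W>_def by (auto dest: cylinders_disjoint)
  have step: "{a \<in> C. a N = j} \<in> sets P \<and> measure P {a \<in> C. a N = j} \<ge> \<delta> * measure P C"
    if C: "C \<in> \<W>" for C
  proof -
    from C obtain w where w: "\<And>i. w i < n" and C_eq: "C = cylinder n w N"
      by (auto simp: \<W>_def cylinders_def topspace_code_topology)
    define v where "v = w(N := j)"
    have v: "v i < n" for i using w j by (simp add: v_def)
    have eq: "{a \<in> C. a N = j} = cylinder n v (Suc N)"
      unfolding C_eq v_def by (auto simp: mem_cylinder less_Suc_eq)
    have "measure P (cylinder n v (Suc N)) = (\<Prod>i<N. g i v) * g N v"
      using measure_cylinder[OF v] by simp
    also have "(\<Prod>i<N. g i v) = (\<Prod>i<N. g i w)"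
      by (intro prod.cong refl g_cong) (auto simp: v_def)
    also have "\<dots> = measure P C"
      unfolding C_eq using measure_cylinder[OF w] by simp
    finally have "measure P {a \<in> C. a N = j} = measure P C * g N v"
      unfolding eq .
    moreover have "g N v \<ge> \<delta>" using v by (intro g_lower)
    ultimately have "measure P {a \<in> C. a N = j} \<ge> \<delta> * measure P C"
      by (simp add: mult.commute[of "measure P C"] mult_right_mono)
    moreover have "cylinder n v (Suc N) \<in> sets P"
      by (rule prefix_determined_measurable[OF sets_P prefix_determined_cylinder])
    ultimately show ?thesis using eq by simp
  qed
  have "\<delta> * measure P E = (\<Sum>C\<in>\<W>. \<delta> * measure P C)"
    using finite_measure_finite_Union[OF fin _ disj] meas
    by (simp add: E_eq image_subset_iff subset_iff sum_distrib_left)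
  also have "\<dots> \<le> (\<Sum>C\<in>\<W>. measure P {a \<in> C. a N = j})"
    using step by (intro sum_mono) auto
  also have "\<dots> = measure P (\<Union>C\<in>\<W>. {a \<in> C. a N = j})"
    using fin step disj
    by (intro finite_measure_finite_Union[symmetric]) (auto simp: disjoint_family_on_def)
  also have "(\<Union>C\<in>\<W>. {a \<in> C. a N = j}) = {a \<in> E. a N = j}"
    by (auto simp: E_eq)
  finally show ?thesis .
qed

lemma measure_next_word:
  assumes E: "prefix_determined n N E" and u: "\<And>i. i < L \<Longrightarrow> u i < n"
  shows "measure P {a \<in> E. \<forall>i<L. a (N + i) = u i} \<ge> \<delta> ^ L * measure P E"
  using u
proof (induction L)
  case (Suc L)
  let ?F = "{a \<in> E. \<forall>i<L. a (N + i) = u i}"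
  have "prefix_determined n (N + L) E"
    using prefix_determined_mono[OF E] by simp
  hence "prefix_determined n (N + L) ?F"
    unfolding prefix_determined_def by (auto simp: mem_cylinder)
  hence "\<delta> * measure P ?F \<le> measure P {a \<in> ?F. a (N + L) = u L}"
    using Suc.prems by (intro measure_next_letter) auto
  moreover have "{a \<in> ?F. a (N + L) = u L} = {a \<in> E. \<forall>i<Suc L. a (N + i) = u i}"
    by (auto simp: less_Suc_eq)
  moreover have "\<delta> * (\<delta> ^ L * measure P E) \<le> \<delta> * measure P ?F"
    using Suc delta_pos by (intro mult_left_mono) auto
  ultimately show ?case by (simp add: mult.assoc)
qed simp

text \<open>
  It suffices to look for the word in the disjoint blocks of length \<open>L\<close> that start at position \<open>k\<close>:
  given that the first \<open>M\<close> blocks failed, which is an event of the past, the next one succeeds with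
  probability at least \<open>\<delta> ^ L\<close>.
\<close>

lemma AE_word_occurs:
  assumes u: "\<And>i. i < L \<Longrightarrow> u i < n"
  shows "AE a in P. \<exists>N\<ge>k. \<forall>i<L. a (N + i) = u i"
proof -
  \<comment> \<open>The event that none of the first \<open>M\<close> blocks is the word.\<close>
  define E where "E M = {a \<in> topspace (code_topology n).
                          \<forall>r<M. \<not> (\<forall>i<L. a (k + r * L + i) = u i)}" for M
  have det: "prefix_determined n (k + M * L) (E M)" for M
    unfolding prefix_determined_def
  proof (intro conjI ballI subsetI)
    fix v w assume v: "v \<in> E M" and w: "w \<in> cylinder n v (k + M * L)"
    have "w (k + r * L + i) = v (k + r * L + i)" if "r < M" "i < L" for r i
    proof -
      have "r * L + i < Suc r * L" using that by simp
      also have "\<dots> \<le> M * L" using that by (intro mult_le_mono1) simp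
      finally show ?thesis using w by (simp add: mem_cylinder)
    qed
    hence "(\<forall>i<L. w (k + r * L + i) = u i) \<longleftrightarrow> (\<forall>i<L. v (k + r * L + i) = u i)" if "r < M" for r
      using that by simp
    moreover have "\<not> (\<forall>i<L. v (k + r * L + i) = u i)" if "r < M" for r
      using v that unfolding E_def by blast
    moreover have "w \<in> topspace (code_topology n)"
      using w by (simp add: cylinder_def)
    ultimately show "w \<in> E M"
      unfolding E_def by blast
  qed (auto simp: E_def)
  have meas: "E M \<in> sets P" for M
    by (rule prefix_determined_measurable[OF sets_P det])
  define q where "q = 1 - \<delta> ^ L"
  \<comment> \<open>That \<open>\<delta> ^ L \<le> 1\<close> comes from the probability of reading the word at the start.\<close>
  have q0: "q \<ge> 0" and q1: "q < 1"
  proof -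
    have "prefix_determined n 0 (topspace (code_topology n))"
      by (auto simp: prefix_determined_def cylinder_def)
    from measure_next_word[OF this u] have "\<delta> ^ L * measure P (space P) \<le>
        measure P {a \<in> topspace (code_topology n). \<forall>i<L. a (0 + i) = u i}"
      by (simp add: space_P)
    also have "\<dots> \<le> 1" by (rule prob_le_1)
    finally show "q \<ge> 0" by (simp add: q_def prob_space)
    show "q < 1" using delta_pos by (simp add: q_def)
  qed
  have decay: "measure P (E M) \<le> q ^ M" for M
  proof (induction M)
    case (Suc M)
    let ?F = "{a \<in> E M. \<forall>i<L. a (k + M * L + i) = u i}"
    have "prefix_determined n (k + M * L + L) (E M)"
      using prefix_determined_mono[OF det] by simp
    hence "prefix_determined n (k + M * L + L) ?F"
      unfolding prefix_determined_def by (auto simp: mem_cylinder)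
    hence F: "?F \<in> sets P" by (rule prefix_determined_measurable[OF sets_P])
    have "E (Suc M) = E M - ?F"
      by (auto simp: E_def less_Suc_eq)
    hence "measure P (E (Suc M)) = measure P (E M) - measure P ?F"
      using finite_measure_Diff[OF meas F] by auto
    also have "\<dots> \<le> q * measure P (E M)"
      using measure_next_word[OF det[of M] u] by (simp add: q_def algebra_simps)
    also have "\<dots> \<le> q * q ^ M"
      using Suc q0 by (intro mult_left_mono)
    finally show ?case by simp
  qed (simp add: prob_le_1)
  define Z where "Z = (\<Inter>M. E M)"
  have Z: "Z \<in> sets P" using meas by (auto simp: Z_def)
  have "measure P Z \<le> q ^ M" for M
  proof -
    have "measure P Z \<le> measure P (E M)"
      using meas by (intro finite_measure_mono) (auto simp: Z_def)
    thus ?thesis using decay[of M] by simp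
  qed
  moreover have "(\<lambda>M. q ^ M) \<longlonglongrightarrow> 0"
    using q0 q1 by (intro LIMSEQ_power_zero) simp
  ultimately have "measure P Z \<le> 0"
    by (intro LIMSEQ_le_const) auto
  hence "measure P Z = 0" by (simp add: measure_le_0_iff)
  show ?thesis
  proof (rule AE_I)
    show "{a \<in> space P. \<not> (\<exists>N\<ge>k. \<forall>i<L. a (N + i) = u i)} \<subseteq> Z"
    proof
      fix a assume a: "a \<in> {a \<in> space P. \<not> (\<exists>N\<ge>k. \<forall>i<L. a (N + i) = u i)}"
      hence "\<not> (\<forall>i<L. a (k + r * L + i) = u i)" for r
        using le_add1[of k "r * L"] by blast
      thus "a \<in> Z" using a by (simp add: Z_def E_def space_P)
    qed
    show "emeasure P Z = 0"
      using \<open>measure P Z = 0\<close> by (simp add: emeasure_eq_measure)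
  qed (rule Z)
qed

text \<open>
  Words are passed through lists here because there are only countably many of them, as the
  exchange of ``almost surely'' and ``for all words'' requires.
\<close>

lemma AE_recurrent:
  "AE a in P. \<forall>u L k. (\<forall>i<L. u i < n) \<longrightarrow> (\<exists>N\<ge>k. \<forall>i<L. a (N + i) = u i)"
proof -
  have "AE a in P. \<forall>us::nat list. \<forall>k. (\<forall>i<length us. us ! i < n) \<longrightarrow>
          (\<exists>N\<ge>k. \<forall>i<length us. a (N + i) = us ! i)"
  proof (intro AE_all_countable[THEN iffD2] allI)
    show "AE a in P. (\<forall>i<length us. us ! i < n) \<longrightarrow>
          (\<exists>N\<ge>k. \<forall>i<length us. a (N + i) = us ! i)" for us k
      using AE_word_occurs[of "length us" "\<lambda>i. us ! i" k]
      by (cases "\<forall>i<length us. us ! i < n") auto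
  qed
  thus ?thesis
  proof (rule AE_mp, intro AE_I2 impI allI)
    fix a u and L k :: nat
    assume *: "\<forall>us::nat list. \<forall>k. (\<forall>i<length us. us ! i < n) \<longrightarrow>
          (\<exists>N\<ge>k. \<forall>i<length us. a (N + i) = us ! i)" and u: "\<forall>i<L. u i < n"
    show "\<exists>N\<ge>k. \<forall>i<L. a (N + i) = u i"
      using *[rule_format, of "map u [0..<L]" k] u by auto
  qed
qed

end

section \<open>Hausdorff limits of orbit tails\<close>

text \<open>
  If every point of \<open>A\<close> is a cluster point of the sequence, then \<open>A\<close> lies in the closure of each
  tail, so one of the two suprema in the Hausdorff distance vanishes; the other one is small as soon
  as the sequence stays near \<open>A\<close>.
\<close>

lemma (in Metric_space) hausdorff_limit_closure_tails:
  assumes compact: "compact_space mtopology"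
    and y: "\<And>N. y N \<in> M"
    and A: "A \<noteq> {}" "compactin mtopology A"
    and recurs: "\<And>a e k. a \<in> A \<Longrightarrow> e > 0 \<Longrightarrow> \<exists>N\<ge>k. d a (y N) < e"
    and attracted: "\<And>e. e > 0 \<Longrightarrow> \<exists>k. \<forall>N\<ge>k. \<exists>a\<in>A. d (y N) a < e"
  shows "hausdorff_limit M d (\<lambda>k. mtopology closure_of {y N |N. N \<ge> k}) A"
proof -
  define F where "F k = mtopology closure_of {y N |N. N \<ge> k}" for k
  have AM: "A \<subseteq> M" using compactin_subset_topspace[OF A(2)] by simp
  have F_alt: "F k = {x \<in> M. \<forall>r>0. \<exists>N\<ge>k. d x (y N) < r}" for k
    unfolding F_def metric_closure_of using y by (fastforce simp: in_mball)
  have AF: "A \<subseteq> F k" for k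
    unfolding F_alt using recurs AM by blast
  have FM: "F k \<subseteq> M" for k by (auto simp: F_alt)
  have F_near: "\<exists>k0. \<forall>k\<ge>k0. \<forall>x\<in>F k. \<exists>a\<in>A. d x a < e" if e: "e > 0" for e
  proof -
    obtain k0 where k0: "\<forall>N\<ge>k0. \<exists>a\<in>A. d (y N) a < e / 2"
      using attracted[of "e / 2"] e by auto
    have "\<exists>a\<in>A. d x a < e" if k: "k \<ge> k0" and x: "x \<in> F k" for k x
    proof -
      from x e obtain N where N: "N \<ge> k" "d x (y N) < e / 2" "x \<in> M"
        unfolding F_alt by (auto dest: spec[of _ "e / 2"])
      have "k0 \<le> N" using k N(1) by simp
      with k0 obtain a where a: "a \<in> A" "d (y N) a < e / 2" by blast
      have "d x a \<le> d x (y N) + d (y N) a"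
        using N(3) y a(1) AM by (intro triangle) auto
      with N(2) a show ?thesis by force
    qed
    thus ?thesis by blast
  qed
  have "(\<lambda>k. hausdorff_dist d (F k) A) \<longlonglongrightarrow> 0"
  proof (rule LIMSEQ_I)
    fix e :: real assume e: "e > 0"
    then obtain k0 where k0: "\<forall>k\<ge>k0. \<forall>x\<in>F k. \<exists>a\<in>A. d x a < e / 2"
      using F_near[of "e / 2"] by auto
    show "\<exists>k0. \<forall>k\<ge>k0. norm (hausdorff_dist d (F k) A - 0) < e"
    proof (intro exI allI impI)
      fix k assume k: "k \<ge> k0"
      have bdd: "bdd_below ((\<lambda>b. d x b) ` S)" "bdd_below ((\<lambda>b. d b x) ` S)" for x S
        by (auto intro!: bdd_belowI2[of _ 0])
      have FA: "(SUP x\<in>F k. INF a\<in>A. d x a) \<le> e / 2"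
      proof (rule cSUP_least)
        show "F k \<noteq> {}" using AF A(1) by blast
        fix x assume "x \<in> F k"
        then obtain a where "a \<in> A" "d x a < e / 2" using k0 k by blast
        thus "(INF a\<in>A. d x a) \<le> e / 2"
          by (intro cINF_lower2[OF bdd(1)]) auto
      qed
      have "(INF x\<in>F k. d x a) = 0" if a: "a \<in> A" for a
      proof (rule antisym)
        have "a \<in> F k" "d a a = 0" using a AF AM by auto
        thus "(INF x\<in>F k. d x a) \<le> 0"
          by (intro cINF_lower2[OF bdd(2)]) auto
        show "0 \<le> (INF x\<in>F k. d x a)"
          using \<open>a \<in> F k\<close> by (intro cINF_greatest) auto
      qed
      hence "(SUP a\<in>A. INF x\<in>F k. d x a) = 0"
        using A(1) by (simp cong: SUP_cong_simp)
      with FA e show "norm (hausdorff_dist d (F k) A - 0) < e"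
        by (simp add: hausdorff_dist_def max_def)
    qed
  qed
  moreover have "F k \<in> nonempty_compacts M d" for k
    unfolding nonempty_compacts_def using AF A(1) compact
    by (auto simp: F_def intro: closedin_compact_space)
  ultimately show ?thesis
    unfolding hausdorff_limit_def nonempty_compacts_def F_def using A by simp
qed

section \<open>Invariant sets of finitely many continuous maps\<close>

text \<open>
  The intersection of the decreasing sequence of iterated images of the whole space. The inclusion
  that needs compactness is that each of its points \<open>y\<close> has a preimage in it: otherwise, for each of
  the finitely many maps, the nested closed sets of preimages of \<open>y\<close> are empty from some stage on,
  and \<open>y\<close> would be missing from the next iterated image.
\<close>

lemma compact_invariant_set_exists:
  fixes n :: nat
  assumes compact: "compact_space T" and haus: "Hausdorff_space T" and ne: "topspace T \<noteq> {}"
    and n: "n > 0" and cont: "\<And>j. j < n \<Longrightarrow> continuous_map T T (f j)"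
  shows "\<exists>B. B \<noteq> {} \<and> compactin T B \<and> (\<Union>j<n. f j ` B) = B"
proof -
  define K where "K = rec_nat (topspace T) (\<lambda>_ B. \<Union>j<n. f j ` B)"
  have K0: "K 0 = topspace T" and KS: "K (Suc N) = (\<Union>j<n. f j ` K N)" for N
    by (simp_all add: K_def)
  have KC: "compactin T (K N)" for N
  proof (induction N)
    case 0
    show ?case using compact by (simp add: K0 compact_space_def)
  next
    case (Suc N)
    thus ?case unfolding KS
      by (intro compactin_Union finite_imageI finite_lessThan) (auto intro: image_compactin cont)
  qed
  have Kcl: "closedin T (K N)" for N
    by (rule compactin_imp_closedin[OF haus KC])
  have Kne: "K N \<noteq> {}" for N
  proof (induction N)
    case 0
    show ?case unfolding K0 by (rule ne)
  next
    case (Suc N)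
    thus ?case using n unfolding KS by blast
  qed
  have Kdec: "K (Suc N) \<subseteq> K N" for N
  proof (induction N)
    case 0
    show ?case using compactin_subset_topspace[OF KC] by (simp add: K0)
  next
    case (Suc N)
    have "(\<Union>j<n. f j ` K (Suc N)) \<subseteq> (\<Union>j<n. f j ` K N)"
      by (intro UN_mono image_mono Suc order_refl)
    thus ?case by (simp only: KS[symmetric])
  qed
  have dec: "decseq K" using Kdec by (rule decseq_SucI)
  define B where "B = (\<Inter>N. K N)"
  have "B \<noteq> {}"
    unfolding B_def using compact Kcl Kne dec by (rule compact_space_imp_nest)
  moreover have "closedin T B"
    unfolding B_def using Kcl by auto
  hence "compactin T B" by (rule closedin_compact_space[OF compact])
  moreover have "(\<Union>j<n. f j ` B) = B"
  proof
    have "(\<Union>j<n. f j ` B) \<subseteq> K (Suc N)" for N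
      unfolding KS B_def by blast
    moreover have "K (Suc N) \<subseteq> K N" for N by (rule Kdec)
    ultimately show "(\<Union>j<n. f j ` B) \<subseteq> B" unfolding B_def by blast
  next
    show "B \<subseteq> (\<Union>j<n. f j ` B)"
    proof
      fix y assume y: "y \<in> B"
      hence yT: "y \<in> topspace T" unfolding B_def using K0 by blast
      define C where "C j N = K N \<inter> {z \<in> topspace T. f j z \<in> {y}}" for j N
      have Ccl: "closedin T (C j N)" if "j < n" for j N
        unfolding C_def
        by (intro closedin_Int Kcl closedin_continuous_map_preimage[OF cont[OF that]]
              closedin_Hausdorff_singleton haus yT)
      have Cdec: "decseq (C j)" for j
        using dec unfolding C_def decseq_def by blast
      show "y \<in> (\<Union>j<n. f j ` B)"
      proof (rule ccontr)
        assume neg: "y \<notin> (\<Union>j<n. f j ` B)"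
        have "\<exists>N. C j N = {}" if j: "j < n" for j
        proof (rule ccontr)
          assume "\<nexists>N. C j N = {}"
          hence "(\<Inter>N. C j N) \<noteq> {}"
            using compact_space_imp_nest[OF compact Ccl[OF j] _ Cdec] by blast
          then obtain z where "\<And>N. z \<in> C j N" by blast
          hence "z \<in> B" "f j z = y" by (auto simp: C_def B_def)
          with neg j show False by blast
        qed
        then obtain r where r: "\<And>j. j < n \<Longrightarrow> C j (r j) = {}" by metis
        define R where "R = Max (r ` {..<n})"
        have "C j R = {}" if "j < n" for j
        proof -
          have "r j \<le> R" unfolding R_def using that by (intro Max_ge) auto
          thus ?thesis using r[OF that] Cdec[of j] unfolding decseq_def by blast
        qed
        moreover obtain j z where "j < n" "z \<in> K R" "y = f j z"
          using y KS[of R] unfolding B_def by blast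
        moreover have "z \<in> topspace T"
          using \<open>z \<in> K R\<close> compactin_subset_topspace[OF KC] by blast
        ultimately show False by (auto simp: C_def)
      qed
    qed
  qed
  ultimately show ?thesis by blast
qed

section \<open>The maximum metric on a power\<close>

lemma dist_inf_le_iff:
  "m \<ge> 1 \<Longrightarrow> dist_inf d m x y \<le> r \<longleftrightarrow> (\<forall>k<m. d (x k) (y k) \<le> r)"
  unfolding dist_inf_def by (subst Max_le_iff) (auto simp: lessThan_empty_iff)

lemma le_dist_inf: "k < m \<Longrightarrow> d (x k) (y k) \<le> dist_inf d m x y"
  unfolding dist_inf_def by (rule Max_ge) auto

lemma power_space_nth: "x \<in> power_space X m \<Longrightarrow> k < m \<Longrightarrow> x k \<in> X"
  by (auto simp: power_space_def)

text \<open>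
  The identity from the product topology to the topology of the maximum metric is continuous, so
  compactness is inherited from Tychonoff's theorem.
\<close>

lemma compact_space_power_topology:
  assumes X: "Metric_space X d" and m: "m \<ge> 1"
    and compact: "compact_space (Metric_space.mtopology X d)"
  shows "compact_space (power_topology X d m)"
proof -
  interpret X: Metric_space X d by fact
  interpret Y: Metric_space "power_space X m" "dist_inf d m"
    using X m by (rule Metric_space_dist_inf)
  let ?P = "product_topology (\<lambda>_. X.mtopology) {..<m}"
  have top: "topspace ?P = power_space X m"
    by (simp add: power_space_def)
  have "continuous_map ?P Y.mtopology (\<lambda>x. x)"
    unfolding Y.continuous_map_to_metric
  proof (intro ballI allI impI)
    fix x and e :: real assume "x \<in> topspace ?P" and e: "e > 0"
    hence x: "x \<in> power_space X m" by (simp only: top)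
    let ?U = "\<Pi>\<^sub>E k\<in>{..<m}. X.mball (x k) (e / 2)"
    have "openin ?P ?U"
      by (subst openin_PiE) auto
    moreover have "x \<in> ?U"
      using x e by (auto simp: power_space_def PiE_iff)
    moreover have "z \<in> Y.mball x e" if z: "z \<in> ?U" for z
    proof -
      have "dist_inf d m x z \<le> e / 2"
        unfolding dist_inf_le_iff[OF m] using z by (auto simp: PiE_iff intro: less_imp_le)
      moreover have "z \<in> power_space X m"
        using z by (auto simp: power_space_def PiE_iff)
      ultimately show ?thesis using x e by simp
    qed
    ultimately show "\<exists>U. openin ?P U \<and> x \<in> U \<and> (\<forall>z\<in>U. z \<in> Y.mball x e)" by blast
  qed
  moreover have "compactin ?P (power_space X m)"
    using compact unfolding top[symmetric] compact_space_def[symmetric]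
    by (simp add: compact_space_product_topology)
  ultimately have "compactin Y.mtopology ((\<lambda>x. x) ` power_space X m)"
    by (rule image_compactin[rotated])
  thus ?thesis by (simp add: compact_space_def)
qed

section \<open>Orbits driven by a code\<close>

lemma orbit_window_nth: "i < m \<Longrightarrow> orbit_window m \<phi> x a N i = orbit m \<phi> x a (N + i)"
  by (simp add: orbit_window_def)

text \<open>
  The orbit is a cocycle over the shift of codes. With \<open>orbit_window_cong\<close> this lets one read a word
  that occurs at position \<open>N\<close> as if it were the start of a code.
\<close>

lemma orbit_shift:
  "orbit m \<phi> (orbit_window m \<phi> x a N) (\<lambda>i. a (N + i)) k = orbit m \<phi> x a (N + k)"
proof (induction k rule: less_induct)
  case (less k)
  show ?case
  proof (cases "k < m")
    case True
    thus ?thesis by (simp add: orbit_initial orbit_window_nth)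
  next
    case False
    then obtain j where k: "k = j + m" by (metis add.commute le_add_diff_inverse not_less)
    have "orbit_window m \<phi> (orbit_window m \<phi> x a N) (\<lambda>i. a (N + i)) j =
          orbit_window m \<phi> x a (N + j)"
      unfolding orbit_window_def[of _ _ _ _ j] orbit_window_def[of _ _ _ _ "N + j"]
      using less by (intro restrict_ext) (simp add: k add.assoc)
    thus ?thesis
      using orbit_step[of m \<phi> "orbit_window m \<phi> x a N" "\<lambda>i. a (N + i)" j]
        orbit_step[of m \<phi> x a "N + j"] by (simp add: k add.assoc)
  qed
qed

lemma orbit_window_shift:
  "orbit_window m \<phi> (orbit_window m \<phi> x a N) (\<lambda>i. a (N + i)) L = orbit_window m \<phi> x a (N + L)"
  by (subst (1 3) orbit_window_def) (simp add: orbit_shift add.assoc)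

lemma orbit_cong:
  "(\<And>i. i + m \<le> k \<Longrightarrow> a i = b i) \<Longrightarrow> orbit m \<phi> x a k = orbit m \<phi> x b k"
proof (induction k rule: less_induct)
  case (less k)
  show ?case
  proof (cases "k < m")
    case True
    thus ?thesis by (simp add: orbit_initial)
  next
    case False
    then obtain j where k: "k = j + m" by (metis add.commute le_add_diff_inverse not_less)
    have "orbit_window m \<phi> x a j = orbit_window m \<phi> x b j"
      unfolding orbit_window_def using less by (intro restrict_ext) (simp add: k)
    thus ?thesis using less.prems by (simp add: k orbit_step)
  qed
qed

lemma orbit_window_cong:
  "(\<And>i. i < N \<Longrightarrow> a i = b i) \<Longrightarrow> orbit_window m \<phi> x a N = orbit_window m \<phi> x b N"
  unfolding orbit_window_def by (intro restrict_ext orbit_cong) auto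

lemma orbit_window_Suc:
  "orbit_window m \<phi> x a (Suc N) = extension m \<phi> (a N) (orbit_window m \<phi> x a N)"
proof
  fix k
  consider "Suc k < m" | "Suc k = m" | "k \<ge> m" by linarith
  thus "orbit_window m \<phi> x a (Suc N) k = extension m \<phi> (a N) (orbit_window m \<phi> x a N) k"
  proof cases
    case 2
    hence "k < m" and index: "Suc N + k = N + m" by simp_all
    with 2 show ?thesis
      by (simp only: orbit_window_nth index orbit_step) (simp add: extension_def)
  qed (simp_all add: orbit_window_def extension_def)
qed

lemma orbit_window_0: "x \<in> power_space X m \<Longrightarrow> orbit_window m \<phi> x a 0 = x"
  unfolding orbit_window_def power_space_def
  by (auto simp: fun_eq_iff orbit_initial PiE_iff extensional_def)

lemma orbit_eq_orbit_window: "m \<ge> 1 \<Longrightarrow> orbit m \<phi> x a N = orbit_window m \<phi> x a N 0"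
  by (simp add: orbit_window_nth)

text \<open>
  The constant \<open>s\<close> bounds all the coefficient sums \<open>\<Sum>k<m. a\<^sub>j\<^sub>k\<close> at once; what the dynamics uses is that
  each \<open>\<phi> j\<close> is then \<open>s\<close>-Lipschitz for the maximum metric.
\<close>

locale contractive_GIFS = X: Metric_space X d
  for X :: "'a set" and d +
  fixes m n :: nat and \<phi> :: "nat \<Rightarrow> (nat \<Rightarrow> 'a) \<Rightarrow> 'a" and s :: real
  assumes m: "m \<ge> 1" and n: "n \<ge> 1" and X_ne: "X \<noteq> {}"
    and compact: "compact_space X.mtopology"
    and s: "0 \<le> s" "s < 1"
    and maps: "\<And>j x. j < n \<Longrightarrow> x \<in> power_space X m \<Longrightarrow> \<phi> j x \<in> X"
    and contract: "\<And>j x y. j < n \<Longrightarrow> x \<in> power_space X m \<Longrightarrow> y \<in> power_space X m \<Longrightarrow>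
                     d (\<phi> j x) (\<phi> j y) \<le> s * dist_inf d m x y"
begin

sublocale Y: Metric_space "power_space X m" "dist_inf d m"
  using X.Metric_space_axioms m by (rule Metric_space_dist_inf)

lemma Y_compact: "compact_space Y.mtopology"
  using X.Metric_space_axioms m compact by (rule compact_space_power_topology)

lemma extension_closed:
  "j < n \<Longrightarrow> x \<in> power_space X m \<Longrightarrow> extension m \<phi> j x \<in> power_space X m"
  using maps unfolding extension_def power_space_def by (auto simp: PiE_iff)

lemma orbit_window_closed:
  assumes "x \<in> power_space X m" "\<And>i. i < N \<Longrightarrow> a i < n"
  shows "orbit_window m \<phi> x a N \<in> power_space X m"
  using assms
  by (induction N) (auto simp: orbit_window_0 orbit_window_Suc intro: extension_closed)

text \<open>
  A coordinate of the orbit gains a factor \<open>s\<close> over all \<open>m\<close> coordinates from which it is computed, and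
  the worst of these lies \<open>m\<close> places back.
\<close>

lemma orbit_contraction:
  assumes x: "x \<in> power_space X m" and y: "y \<in> power_space X m"
    and a: "\<And>i. i + m \<le> k \<Longrightarrow> a i < n"
  shows "d (orbit m \<phi> x a k) (orbit m \<phi> y a k) \<le> s ^ (k div m) * dist_inf d m x y"
  using a
proof (induction k rule: less_induct)
  case (less k)
  show ?case
  proof (cases "k < m")
    case True
    thus ?thesis by (simp add: orbit_initial le_dist_inf)
  next
    case False
    then obtain j where k: "k = j + m" by (metis add.commute le_add_diff_inverse not_less)
    have "dist_inf d m (orbit_window m \<phi> x a j) (orbit_window m \<phi> y a j) \<le>
          s ^ (j div m) * dist_inf d m x y"
    proof (subst dist_inf_le_iff[OF m], intro allI impI)
      fix i assume i: "i < m"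
      have "d (orbit m \<phi> x a (j + i)) (orbit m \<phi> y a (j + i)) \<le>
            s ^ ((j + i) div m) * dist_inf d m x y"
        using i less by (auto simp: k)
      also have "\<dots> \<le> s ^ (j div m) * dist_inf d m x y"
        using s by (intro mult_right_mono power_decreasing div_le_mono) auto
      finally show "d (orbit_window m \<phi> x a j i) (orbit_window m \<phi> y a j i) \<le>
                    s ^ (j div m) * dist_inf d m x y"
        using i by (simp add: orbit_window_nth)
    qed
    hence "s * dist_inf d m (orbit_window m \<phi> x a j) (orbit_window m \<phi> y a j) \<le>
           s * (s ^ (j div m) * dist_inf d m x y)"
      using s by (intro mult_left_mono)
    moreover have "d (orbit m \<phi> x a k) (orbit m \<phi> y a k) \<le>
          s * dist_inf d m (orbit_window m \<phi> x a j) (orbit_window m \<phi> y a j)"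
      unfolding k orbit_step using less.prems x y
      by (intro contract orbit_window_closed) (auto simp: k)
    moreover have "k div m = Suc (j div m)" using m by (simp add: k)
    ultimately show ?thesis by (simp add: mult.assoc)
  qed
qed

lemma orbit_window_contraction:
  assumes x: "x \<in> power_space X m" and y: "y \<in> power_space X m"
    and a: "\<And>i. i < N \<Longrightarrow> a i < n"
  shows "dist_inf d m (orbit_window m \<phi> x a N) (orbit_window m \<phi> y a N) \<le>
         s ^ (N div m) * dist_inf d m x y"
proof (subst dist_inf_le_iff[OF m], intro allI impI)
  fix i assume i: "i < m"
  have "d (orbit m \<phi> x a (N + i)) (orbit m \<phi> y a (N + i)) \<le>
        s ^ ((N + i) div m) * dist_inf d m x y"
    using x y i a by (intro orbit_contraction) auto
  also have "\<dots> \<le> s ^ (N div m) * dist_inf d m x y"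
    using s by (intro mult_right_mono power_decreasing div_le_mono) auto
  finally show "d (orbit_window m \<phi> x a N i) (orbit_window m \<phi> y a N i) \<le>
                s ^ (N div m) * dist_inf d m x y"
    using i by (simp add: orbit_window_nth)
qed

lemma uniform_contraction:
  assumes e: "e > 0"
  shows "\<exists>r. \<forall>N\<ge>r. \<forall>x\<in>power_space X m. \<forall>y\<in>power_space X m. \<forall>a. (\<forall>i<N. a i < n) \<longrightarrow>
           dist_inf d m (orbit_window m \<phi> x a N) (orbit_window m \<phi> y a N) < e"
proof -
  have "Y.mbounded (power_space X m)"
    using Y_compact by (intro Y.compactin_imp_mbounded) (simp add: compact_space_def)
  then obtain D where D: "D > 0"
      "\<And>x y. x \<in> power_space X m \<Longrightarrow> y \<in> power_space X m \<Longrightarrow> dist_inf d m x y \<le> D"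
    unfolding Y.mbounded_alt_pos by blast
  obtain q where q: "s ^ q < e / D"
    using real_arch_pow_inv[of "e / D" s] s e D(1) by auto
  have "dist_inf d m (orbit_window m \<phi> x a N) (orbit_window m \<phi> y a N) < e"
    if N: "N \<ge> m * q" and x: "x \<in> power_space X m" and y: "y \<in> power_space X m"
      and a: "\<forall>i<N. a i < n" for N x y a
  proof -
    have "q \<le> N div m"
      using N m by (simp add: less_eq_div_iff_mult_less_eq mult.commute)
    hence "s ^ (N div m) * dist_inf d m x y \<le> s ^ q * D"
      using s D(2)[OF x y] by (intro mult_mono power_decreasing) auto
    also have "\<dots> < e" using q D(1) by (simp add: pos_less_divide_eq)
    finally show ?thesis
      using orbit_window_contraction[OF x y, of N a] a by force
  qed
  thus ?thesis by blast
qed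

lemma extension_nonexpansive:
  assumes "j < n" "x \<in> power_space X m" "y \<in> power_space X m"
  shows "dist_inf d m (extension m \<phi> j x) (extension m \<phi> j y) \<le> dist_inf d m x y"
proof (subst dist_inf_le_iff[OF m], intro allI impI)
  fix k assume k: "k < m"
  have "s * dist_inf d m x y \<le> 1 * dist_inf d m x y"
    using s by (intro mult_right_mono) auto
  with contract[OF assms] k
  show "d (extension m \<phi> j x k) (extension m \<phi> j y k) \<le> dist_inf d m x y"
    by (auto simp: extension_def le_dist_inf)
qed

lemma extension_continuous:
  assumes j: "j < n"
  shows "continuous_map Y.mtopology Y.mtopology (extension m \<phi> j)"
  unfolding Y.continuous_map_to_metric
proof (intro ballI allI impI)
  fix x and e :: real assume "x \<in> topspace Y.mtopology" and e: "e > 0"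
  hence x: "x \<in> power_space X m" by simp
  have "extension m \<phi> j z \<in> Y.mball (extension m \<phi> j x) e" if z: "z \<in> Y.mball x e" for z
    using extension_nonexpansive[OF j x, of z] z extension_closed[OF j] by auto
  thus "\<exists>U. openin Y.mtopology U \<and> x \<in> U \<and>
          (\<forall>z\<in>U. extension m \<phi> j z \<in> Y.mball (extension m \<phi> j x) e)"
    using x e by (intro exI[of _ "Y.mball x e"]) auto
qed

lemma invariant_orbit_window:
  assumes "B \<subseteq> power_space X m" "(\<Union>j<n. extension m \<phi> j ` B) \<subseteq> B" "z \<in> B"
    and "\<And>i. i < N \<Longrightarrow> a i < n"
  shows "orbit_window m \<phi> z a N \<in> B"
  using assms(4)
proof (induction N)
  case 0
  have "orbit_window m \<phi> z a 0 = z"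
    using assms(1,3) by (blast intro: orbit_window_0)
  thus ?case using assms(3) by simp
next
  case (Suc N)
  thus ?case using assms(2) by (auto simp: orbit_window_Suc)
qed

text \<open>
  The letters of the word are found from the last to the first, each one appended at the end of the
  code of the preceding point.
\<close>

lemma invariant_backward_orbit:
  assumes B: "B \<subseteq> power_space X m" "B \<subseteq> (\<Union>j<n. extension m \<phi> j ` B)" and y: "y \<in> B"
  shows "\<exists>z\<in>B. \<exists>a. (\<forall>i<N. a i < n) \<and> y = orbit_window m \<phi> z a N"
  using y
proof (induction N arbitrary: y)
  case 0
  have "orbit_window m \<phi> y (\<lambda>_. 0) 0 = y"
    using B(1) 0 by (blast intro: orbit_window_0)
  thus ?case using 0 by (metis not_less_zero)
next
  case (Suc N)
  then obtain j y' where j: "j < n" "y' \<in> B" "y = extension m \<phi> j y'" using B(2) by blast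
  from Suc.IH[OF j(2)] obtain z a where z: "z \<in> B" "\<forall>i<N. a i < n" "y' = orbit_window m \<phi> z a N"
    by blast
  have "orbit_window m \<phi> z (a(N := j)) N = orbit_window m \<phi> z a N"
    by (rule orbit_window_cong) simp
  hence "y = orbit_window m \<phi> z (a(N := j)) (Suc N)"
    using j z by (simp add: orbit_window_Suc)
  moreover have "\<forall>i<Suc N. (a(N := j)) i < n"
    using j z by (simp add: less_Suc_eq)
  ultimately show ?case using z(1) by blast
qed

text \<open>
  Comparison of two half-invariant sets, from which uniqueness of the attractor follows by symmetry:
  a point of \<open>B\<close> is the end of an arbitrarily long word applied to a point of \<open>B\<close>, and the same word
  applied to a point of \<open>C\<close> ends nearby, still in \<open>C\<close>.
\<close>

lemma invariant_subset:
  assumes B: "B \<subseteq> power_space X m" "B \<subseteq> (\<Union>j<n. extension m \<phi> j ` B)"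
    and C: "C \<noteq> {}" "closedin Y.mtopology C" "(\<Union>j<n. extension m \<phi> j ` C) \<subseteq> C"
  shows "B \<subseteq> C"
proof
  fix y assume y: "y \<in> B"
  have CY: "C \<subseteq> power_space X m" using closedin_subset[OF C(2)] by simp
  obtain c where c: "c \<in> C" using C(1) by blast
  have "\<exists>z\<in>C. z \<in> Y.mball y e" if e: "e > 0" for e
  proof -
    obtain N where N: "\<And>x y a. x \<in> power_space X m \<Longrightarrow> y \<in> power_space X m \<Longrightarrow> (\<forall>i<N. a i < n) \<Longrightarrow>
        dist_inf d m (orbit_window m \<phi> x a N) (orbit_window m \<phi> y a N) < e"
      using uniform_contraction[OF e] by blast
    obtain z a where z: "z \<in> B" "\<forall>i<N. a i < n" "y = orbit_window m \<phi> z a N"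
      using invariant_backward_orbit[OF B y] by blast
    have "orbit_window m \<phi> c a N \<in> C"
      using invariant_orbit_window[OF CY C(3) c] z(2) by blast
    moreover have "orbit_window m \<phi> c a N \<in> Y.mball y e"
      using N[of z c a] z B(1) CY c y calculation by (auto simp: subset_iff)
    ultimately show ?thesis by blast
  qed
  hence "y \<in> Y.mtopology closure_of C"
    unfolding Y.metric_closure_of using y B(1) by blast
  thus "y \<in> C" using C(2) closure_of_closedin by blast
qed

lemma attractor_properties:
  "attractor X d m n \<phi> \<noteq> {} \<and> compactin Y.mtopology (attractor X d m n \<phi>) \<and>
   (\<Union>j<n. extension m \<phi> j ` attractor X d m n \<phi>) = attractor X d m n \<phi>"
  unfolding attractor_def
proof (rule theI', rule ex_ex1I)
  have "power_space X m \<noteq> {}"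
    using X_ne by (simp add: power_space_def PiE_eq_empty_iff)
  thus "\<exists>B. B \<noteq> {} \<and> compactin Y.mtopology B \<and> (\<Union>j<n. extension m \<phi> j ` B) = B"
    using n by (intro compact_invariant_set_exists Y_compact Y.Hausdorff_space_mtopology
                  extension_continuous) auto
next
  have sub: "B \<subseteq> C" if "compactin Y.mtopology B" "(\<Union>j<n. extension m \<phi> j ` B) = B"
    "C \<noteq> {}" "compactin Y.mtopology C" "(\<Union>j<n. extension m \<phi> j ` C) = C" for B C
  proof (rule invariant_subset)
    show "B \<subseteq> power_space X m"
      using compactin_subset_topspace[OF that(1)] by simp
    show "closedin Y.mtopology C"
      by (rule compactin_imp_closedin[OF Y.Hausdorff_space_mtopology that(4)])
  qed (rule that equalityD1[OF that(5)] equalityD2[OF that(2)])+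
  fix B C
  assume B: "B \<noteq> {} \<and> compactin Y.mtopology B \<and> (\<Union>j<n. extension m \<phi> j ` B) = B"
    and C: "C \<noteq> {} \<and> compactin Y.mtopology C \<and> (\<Union>j<n. extension m \<phi> j ` C) = C"
  show "B = C" using sub[of B C] sub[of C B] B C by (elim conjE) (rule equalityI)
qed

abbreviation \<A> where "\<A> \<equiv> attractor X d m n \<phi>"

lemma attractor_nonempty: "\<A> \<noteq> {}"
  and attractor_compact: "compactin Y.mtopology \<A>"
  and attractor_invariant: "(\<Union>j<n. extension m \<phi> j ` \<A>) = \<A>"
  using attractor_properties by blast+

lemma attractor_subset: "\<A> \<subseteq> power_space X m"
  using compactin_subset_topspace[OF attractor_compact] by simp

text \<open>An orbit that starts in the attractor stays there and serves as a moving target.\<close>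

lemma orbit_attracted:
  assumes x: "x \<in> power_space X m" and a: "\<And>i. a i < n" and e: "e > 0"
  shows "\<exists>k. \<forall>N\<ge>k. \<exists>y\<in>\<A>. dist_inf d m (orbit_window m \<phi> x a N) y < e"
proof -
  obtain z where z: "z \<in> \<A>" using attractor_nonempty by blast
  have "orbit_window m \<phi> z a N \<in> \<A>" for N
    using attractor_subset attractor_invariant z a by (intro invariant_orbit_window) auto
  moreover have "z \<in> power_space X m" using z attractor_subset by blast
  ultimately show ?thesis
    using uniform_contraction[OF e] x a by meson
qed

text \<open>
  Write \<open>y\<close> as the result of a long word \<open>u\<close> applied to a point of the attractor. Whenever the code
  contains \<open>u\<close>, the orbit ends close to \<open>y\<close>, whatever its position before the word.
\<close>

lemma orbit_recurs:
  assumes x: "x \<in> power_space X m" and a: "\<And>i. a i < n"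
    and rec: "\<And>u L k. (\<forall>i<L. u i < n) \<Longrightarrow> \<exists>N\<ge>k. \<forall>i<L. a (N + i) = u i"
    and y: "y \<in> \<A>" and e: "e > 0"
  shows "\<exists>N\<ge>k. dist_inf d m y (orbit_window m \<phi> x a N) < e"
proof -
  obtain L where L: "\<And>x y a. x \<in> power_space X m \<Longrightarrow> y \<in> power_space X m \<Longrightarrow> (\<forall>i<L. a i < n) \<Longrightarrow>
      dist_inf d m (orbit_window m \<phi> x a L) (orbit_window m \<phi> y a L) < e"
    using uniform_contraction[OF e] by blast
  obtain z u where z: "z \<in> \<A>" "\<forall>i<L. u i < n" "y = orbit_window m \<phi> z u L"
    using invariant_backward_orbit[of \<A> y L] attractor_subset attractor_invariant y by auto
  obtain N where N: "N \<ge> k" "\<forall>i<L. a (N + i) = u i" using rec[OF z(2)] by blast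
  let ?w = "orbit_window m \<phi> x a N"
  have "orbit_window m \<phi> x a (N + L) = orbit_window m \<phi> ?w (\<lambda>i. a (N + i)) L"
    by (simp add: orbit_window_shift)
  also have "\<dots> = orbit_window m \<phi> ?w u L"
    using N(2) by (intro orbit_window_cong) auto
  finally have "dist_inf d m y (orbit_window m \<phi> x a (N + L)) < e"
    using L[of z ?w u] z attractor_subset orbit_window_closed[OF x, of N a] a by auto
  thus ?thesis using N(1) trans_le_add1 by blast
qed

lemma recurrent_code_hausdorff_limit:
  assumes x: "x \<in> power_space X m" and a: "\<And>i. a i < n"
    and rec: "\<And>u L k. (\<forall>i<L. u i < n) \<Longrightarrow> \<exists>N\<ge>k. \<forall>i<L. a (N + i) = u i"
  shows "hausdorff_limit (power_space X m) (dist_inf d m)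
           (\<lambda>k. Y.mtopology closure_of {orbit_window m \<phi> x a N |N. N \<ge> k}) \<A>" (is ?window)
    and "hausdorff_limit X d
           (\<lambda>k. X.mtopology closure_of {orbit m \<phi> x a N |N. N \<ge> k}) ((\<lambda>y. y 0) ` \<A>)" (is ?proj)
proof -
  show ?window
    by (rule Y.hausdorff_limit_closure_tails[OF Y_compact orbit_window_closed[OF x a]
          attractor_nonempty attractor_compact orbit_recurs[OF x a rec] orbit_attracted[OF x a]])
  have coord: "d (v 0) (w 0) \<le> dist_inf d m v w" for v w :: "nat \<Rightarrow> 'a"
    using m by (intro le_dist_inf) auto
  have nth0: "v 0 \<in> X" if "v \<in> power_space X m" for v
    using power_space_nth[OF that, of 0] m by simp
  have "continuous_map Y.mtopology X.mtopology (\<lambda>y. y 0)"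
    unfolding X.continuous_map_to_metric
  proof (intro ballI allI impI)
    fix v and e :: real assume "v \<in> topspace Y.mtopology" and e: "e > 0"
    hence v: "v \<in> power_space X m" by simp
    have "z 0 \<in> X.mball (v 0) e" if "z \<in> Y.mball v e" for z
      using coord[of v z] that nth0 by auto
    thus "\<exists>U. openin Y.mtopology U \<and> v \<in> U \<and> (\<forall>z\<in>U. z 0 \<in> X.mball (v 0) e)"
      using v e by (intro exI[of _ "Y.mball v e"]) auto
  qed
  hence compact_proj: "compactin X.mtopology ((\<lambda>y. y 0) ` \<A>)"
    by (rule image_compactin[OF attractor_compact])
  show ?proj
    unfolding orbit_eq_orbit_window[OF m]
  proof (intro X.hausdorff_limit_closure_tails compact compact_proj)
    show "orbit_window m \<phi> x a N 0 \<in> X" for N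
      by (intro nth0 orbit_window_closed x a)
    show "(\<lambda>y. y 0) ` \<A> \<noteq> {}" using attractor_nonempty by blast
    show "\<exists>N\<ge>k. d y0 (orbit_window m \<phi> x a N 0) < e"
      if y0: "y0 \<in> (\<lambda>y. y 0) ` \<A>" and e: "e > 0" for y0 e k
    proof -
      from y0 obtain y where y: "y \<in> \<A>" "y0 = y 0" by blast
      from orbit_recurs[of x a y e k, OF x a rec y(1) e] obtain N
        where "N \<ge> k" "dist_inf d m y (orbit_window m \<phi> x a N) < e" by blast
      thus ?thesis using coord[of y "orbit_window m \<phi> x a N"] y(2) by (auto intro: le_less_trans)
    qed
    show "\<exists>k. \<forall>N\<ge>k. \<exists>y0\<in>(\<lambda>y. y 0) ` \<A>. d (orbit_window m \<phi> x a N 0) y0 < e"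
      if e: "e > 0" for e
    proof -
      from orbit_attracted[of x a e, OF x a e] obtain k
        where k: "\<forall>N\<ge>k. \<exists>y\<in>\<A>. dist_inf d m (orbit_window m \<phi> x a N) y < e" by blast
      have "\<exists>y\<in>\<A>. d (orbit_window m \<phi> x a N 0) (y 0) < e" if "N \<ge> k" for N
        using k that coord le_less_trans by blast
      thus ?thesis by blast
    qed
  qed
qed

end

section \<open>Almost sure convergence of orbit tails to the attractor\<close>

theorem theorem26:
  fixes X :: "'a set" and d :: "'a \<Rightarrow> 'a \<Rightarrow> real"
    and m n :: nat
    and \<phi> :: "nat \<Rightarrow> (nat \<Rightarrow> 'a) \<Rightarrow> 'a"
    and p :: "nat \<Rightarrow> (nat \<Rightarrow> 'a) \<Rightarrow> real"
    and x :: "nat \<Rightarrow> 'a"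
  assumes mn: "m \<ge> 2" "n \<ge> 2"
    and X: "X \<noteq> {}" "Metric_space X d" "compact_space (Metric_space.mtopology X d)"
    and S: "GIFSpdp X d m n \<phi> p"
    and E1: "\<And>j. j < n \<Longrightarrow> \<exists>a :: nat \<Rightarrow> real. (\<forall>k<m. a k > 0) \<and> (\<Sum>k<m. a k) < 1 \<and>
              (\<forall>x\<in>power_space X m. \<forall>y\<in>power_space X m.
                 d (\<phi> j x) (\<phi> j y) \<le> (\<Sum>k<m. a k * d (x k) (y k)))"
    and E2_lower: "\<exists>\<delta>>0. \<forall>j<n. \<forall>x\<in>power_space X m. p j x \<ge> \<delta>"
    and E2_lip: "\<And>j. j < n \<Longrightarrow> \<exists>c :: nat \<Rightarrow> real. (\<forall>k<m. c k > 0) \<and> (\<Sum>k<m. c k) < 1 \<and>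
              (\<forall>x\<in>power_space X m. \<forall>y\<in>power_space X m.
                 \<bar>p j x - p j y\<bar> \<le> (\<Sum>k<m. c k * d (x k) (y k)))"
    and x: "x \<in> power_space X m"
  shows "(AE a in orbit_measure m n \<phi> p x.
            hausdorff_limit (power_space X m) (dist_inf d m)
              (\<lambda>k. power_topology X d m closure_of {orbit_window m \<phi> x a N |N. N \<ge> k})
              (attractor X d m n \<phi>)) \<and>
         (AE a in orbit_measure m n \<phi> p x.
            hausdorff_limit X d
              (\<lambda>k. Metric_space.mtopology X d closure_of {orbit m \<phi> x a N |N. N \<ge> k})
              ((\<lambda>y. y 0) ` attractor X d m n \<phi>))"
proof -
  interpret X: Metric_space X d by fact
  obtain A where A: "\<And>j k. j < n \<Longrightarrow> k < m \<Longrightarrow> A j k > 0" "\<And>j. j < n \<Longrightarrow> (\<Sum>k<m. A j k) < (1::real)"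
    "\<And>j x y. j < n \<Longrightarrow> x \<in> power_space X m \<Longrightarrow> y \<in> power_space X m \<Longrightarrow>
       d (\<phi> j x) (\<phi> j y) \<le> (\<Sum>k<m. A j k * d (x k) (y k))"
    using E1 by metis
  define s where "s = Max ((\<lambda>j. \<Sum>k<m. A j k) ` {..<n})"
  have A_le: "(\<Sum>k<m. A j k) \<le> s" if "j < n" for j
    unfolding s_def using that by (intro Max_ge) auto
  interpret contractive_GIFS X d m n \<phi> s
  proof
    show "m \<ge> 1" "n \<ge> 1" using mn by auto
    show "X \<noteq> {}" "compact_space X.mtopology" by fact+
    have "0 \<le> (\<Sum>k<m. A 0 k)" using A(1)[of 0] mn by (intro sum_nonneg less_imp_le) auto
    also have "\<dots> \<le> s" using A_le[of 0] mn by simp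
    finally show "0 \<le> s" .
    show "s < 1" unfolding s_def using A(2) mn by (subst Max_less_iff) (auto simp: lessThan_empty_iff)
    show "\<phi> j y \<in> X" if "j < n" "y \<in> power_space X m" for j y
    proof -
      interpret Y: Metric_space "power_space X m" "dist_inf d m"
        using X(2) mn by (intro Metric_space_dist_inf) auto
      have "continuous_map Y.mtopology X.mtopology (\<phi> j)"
        using S that(1) by (simp add: GIFSpdp_def)
      from continuous_map_image_subset_topspace[OF this] show ?thesis
        using that(2) by auto
    qed
    show "d (\<phi> j y) (\<phi> j z) \<le> s * dist_inf d m y z"
      if j: "j < n" and y: "y \<in> power_space X m" and z: "z \<in> power_space X m" for j y z
    proof -
      have "d (\<phi> j y) (\<phi> j z) \<le> (\<Sum>k<m. A j k * d (y k) (z k))"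
        by (rule A(3)[OF j y z])
      also have "\<dots> \<le> (\<Sum>k<m. A j k * dist_inf d m y z)"
        using A(1)[OF j] by (intro sum_mono mult_left_mono le_dist_inf) (auto intro: less_imp_le)
      also have "\<dots> \<le> s * dist_inf d m y z"
        unfolding sum_distrib_right[symmetric]
      proof (rule mult_right_mono[OF A_le[OF j]])
        show "0 \<le> dist_inf d m y z"
          using X.nonneg mn by (intro order_trans[OF _ le_dist_inf[of 0 m d y z]]) auto
      qed
      finally show ?thesis .
    qed
  qed
  define g where "g N w = p (w N) (orbit_window m \<phi> x w N)" for N w
  interpret code_weights n g
  proof
    show "g N v = g N w" if "\<And>i. i \<le> N \<Longrightarrow> v i = w i" for N v w
      unfolding g_def using that orbit_window_cong[of N v w m \<phi> x] by simp
    show "0 \<le> g N w" if "\<And>i. i \<le> N \<Longrightarrow> w i < n" for N w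
      using S that orbit_window_closed[OF x, of N w] unfolding g_def GIFSpdp_def by auto
    show "(\<Sum>j<n. g N (w(N := j))) = 1" if "\<And>i. i < N \<Longrightarrow> w i < n" for N w
    proof -
      have "orbit_window m \<phi> x (w(N := j)) N = orbit_window m \<phi> x w N" for j
        by (rule orbit_window_cong) simp
      thus ?thesis
        using S orbit_window_closed[OF x, of N w] that by (simp add: g_def GIFSpdp_def)
    qed
  qed
  have orbit_measure_eq: "orbit_measure m n \<phi> p x = (THE P. is_code_measure P)"
    by (simp add: orbit_measure_def is_code_measure_def g_def)
  have code: "is_code_measure (orbit_measure m n \<phi> p x)"
  proof -
    obtain P where P: "is_code_measure P" using code_measure_exists by blast
    have "orbit_measure m n \<phi> p x = P"
      unfolding orbit_measure_eq using P code_measure_unique[OF _ P] by (rule the_equality)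
    thus ?thesis using P by simp
  qed
  obtain \<delta> where \<delta>: "\<delta> > 0" "\<And>j y. j < n \<Longrightarrow> y \<in> power_space X m \<Longrightarrow> p j y \<ge> \<delta>"
    using E2_lower by blast
  interpret positive_code_weights n g \<delta> "orbit_measure m n \<phi> p x"
  proof
    show "\<delta> \<le> g N w" if "\<And>i. i \<le> N \<Longrightarrow> w i < n" for N w
      unfolding g_def using that by (intro \<delta>(2) orbit_window_closed x) simp_all
  qed (rule \<delta>(1) code)+
  have recurrent: "AE a in orbit_measure m n \<phi> p x. (\<forall>i. a i < n) \<and>
          (\<forall>u L k. (\<forall>i<L. u i < n) \<longrightarrow> (\<exists>N\<ge>k. \<forall>i<L. a (N + i) = u i))"
    using AE_recurrent AE_space by eventually_elim (simp add: space_P topspace_code_topology)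
  show ?thesis
  proof (intro conjI; rule AE_mp[OF recurrent]; intro AE_I2 impI)
    fix a :: "nat \<Rightarrow> nat"
    assume R: "(\<forall>i. a i < n) \<and>
          (\<forall>u L k. (\<forall>i<L. u i < n) \<longrightarrow> (\<exists>N\<ge>k. \<forall>i<L. a (N + i) = u i))"
    have letters: "a i < n" for i
      using R by blast
    have words: "\<exists>N\<ge>k. \<forall>i<L. a (N + i) = u i" if "\<forall>i<L. u i < n" for u L k
      using R[THEN conjunct2, THEN spec, of u, THEN spec, of L, THEN spec, of k] that by (rule mp)
    show "hausdorff_limit (power_space X m) (dist_inf d m)
            (\<lambda>k. power_topology X d m closure_of {orbit_window m \<phi> x a N |N. N \<ge> k})
            (attractor X d m n \<phi>)"
      by (rule recurrent_code_hausdorff_limit(1)[OF x letters words])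
    show "hausdorff_limit X d
            (\<lambda>k. Metric_space.mtopology X d closure_of {orbit m \<phi> x a N |N. N \<ge> k})
            ((\<lambda>y. y 0) ` attractor X d m n \<phi>)"
      by (rule recurrent_code_hausdorff_limit(2)[OF x letters words])
  qed
qed

end
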